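(* Let $f:\mathbb{R}^n\to\mathbb{R}^n$ be a $C^3$ function with $f(x^* )=0$, let $N=\operatorname{null}(f'(x^* ))$ and $R=\operatorname{range}(f'(x^* ))$ with $R\perp N$, let $\dim N=1$, and let $\hat D$ be invertible as a map on $N$. Let $\hat r\in(0,1)$. For iterates $x_k$, put $$W_k:=B_{\|e_k\|}(x^* )\cap\{x:\|P_R(x-x^* )\|<\sigma_k\|P_N(x-x^* )\|\}.$$ If $x_0$ is chosen so that $\sigma_0<\hat\sigma$ and $\|e_0\|<\hat\rho$, for sufficiently small $\hat\sigma>0$ and $\hat\rho>0$, $x_1=x_0+w_1$, and $$x_{k+1}=x_k+w_{k+1}-\lambda_{k+1}\gamma_{k+1}(x_k-x_{k-1}+w_{k+1}-w_k)\quad\text{for } k\ge 1,$$ where $\lambda_{k+1}$ and $\gamma_{k+1}$ are computed by the adaptive $\gamma$-safeguarded Newton-Anderson algorithm with parameter $\hat r$, then $W_{k+1}\subset W_0$ for all $k\ge 0$ and $x_k\to x^*$. That is, $\{x_k\}$ remains well-defined and converges to $x^*$. Furthermore, there exist constants $C>0$ and $\kappa\in(1/2,1)$ such that $$\|P_Re_{k+1}\|\le C\max\{|1-\lambda_{k+1}\gamma_{k+1}|\,\|e_k\|^2,\ |\lambda_{k+1}\gamma_{k+1}|\,\|e_{k-1}\|^2\},$$ $$\|P_Ne_{k+1}\|\le \kappa\,\theta_{k+1}^{\lambda}\,\|P_Ne_k\|$$ for all $k\ge 1$.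
   Context: $\|\cdot\|$ is the Euclidean norm and $B_\rho(x)$ is the ball of radius $\rho$ centered at $x$. $P_N$ and $P_R$ are the orthogonal projections onto $N$ and $R$. Let $\varphi\neq0$ span $N$; $\hat D$ is the linear operator $\hat D(\cdot):=P_Nf''(x^* )(\varphi,P_N(\cdot))$, regarded as a map from $N$ to $N$. Notation: $e_k=x_k-x^*$, $w_{k+1}=-f'(x_k)^{-1}f(x_k)$, and $\sigma_k=\|P_Re_k\|/\|P_Ne_k\|$. In addition, $$\theta_{k+1}^{\lambda}=\frac{\|w_{k+1}-\lambda_{k+1}\gamma_{k+1}(w_{k+1}-w_k)\|}{\|w_{k+1}\|}.$$ Adaptive $\gamma$-safeguarded Newton-Anderson algorithm with parameter $\hat r\in(0,1)$: choose $x_0$, set $w_1=-f'(x_0)^{-1}f(x_0)$ and $x_1=x_0+w_1$. For $k=1,2,\dots$: - $w_{k+1}=-f'(x_k)^{-1}f(x_k)$; - $\gamma_{k+1}=(w_{k+1}-w_k)^Tw_{k+1}/\|w_{k+1}-w_k\|^2$; - $\eta_{k+1}=\|w_{k+1}\|/\|w_k\|$, $r_{k+1}=\min\{\eta_{k+1},\hat r\}$, $\beta_{k+1}=r_{k+1}\eta_{k+1}$; - if $\gamma_{k+1}=0$ or $\gamma_{k+1}\ge 1$, set $\lambda_{k+1}=0$; else if $|\gamma_{k+1}|/|1-\gamma_{k+1}|>\beta_{k+1}$, set $\lambda_{k+1}=\dfrac{\beta_{k+1}}{\gamma_{k+1}(\beta_{k+1}+\operatorname{sign}(\gamma_{k+1}))}$;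 otherwise set $\lambda_{k+1}=1$; - $x_{k+1}=x_k+w_{k+1}-\lambda_{k+1}\gamma_{k+1}(x_k-x_{k-1}+w_{k+1}-w_k)$.
   Formalization: W_{k+1} ⊂ W_0 can fail if σ_0 is small relative to ‖e_0‖ (f=(x²,y+x³), σ_0<x_0²); it is proved with ρ̂ depending on a positive lower bound for σ_0, and uniformly only W_{k+1} ⊂ the region of radius ρ̂ and slope σ̂. P_N e_0 ≠ 0 is assumed so that σ_0 is defined. *)

theory Defs
  imports "HOL-Analysis.Analysis"
begin

subsection \<open>Derivatives\<close>

text \<open>
  The derivative as a bounded linear map; iterating it gives the second derivative
  \<open>fderiv (fderiv f) x u v\<close>, i.e. f''(x)(u,v), and the third. The value is meaningful only where
  the function is differentiable.
\<close>

definition fderiv ::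
  "('a::real_normed_vector \<Rightarrow> 'b::real_normed_vector) \<Rightarrow> 'a \<Rightarrow> 'a \<Rightarrow>\<^sub>L 'b" where
  "fderiv f x = Blinfun (frechet_derivative f (at x))"

definition C3 :: "('a::real_normed_vector \<Rightarrow> 'b::real_normed_vector) \<Rightarrow> bool" where
  "C3 f \<longleftrightarrow>
     (\<forall>x. f differentiable at x) \<and>
     (\<forall>x. fderiv f differentiable at x) \<and>
     (\<forall>x. fderiv (fderiv f) differentiable at x) \<and>
     continuous_on UNIV (fderiv (fderiv (fderiv f)))"

subsection \<open>Null space, range, projections\<close>

definition nullsp :: "('a::real_normed_vector \<Rightarrow>\<^sub>L 'b::real_normed_vector) \<Rightarrow> 'a set" where
  "nullsp A = {v. blinfun_apply A v = 0}"

definition rangesp :: "('a::real_normed_vector \<Rightarrow>\<^sub>L 'b::real_normed_vector) \<Rightarrow> 'b set" where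
  "rangesp A = range (blinfun_apply A)"

text \<open>Used only for linear subspaces \<open>S\<close> of a Euclidean space, where the point exists uniquely.\<close>

definition orth_proj :: "'a::euclidean_space set \<Rightarrow> 'a \<Rightarrow> 'a" where
  "orth_proj S v = (THE p. p \<in> S \<and> (\<forall>z\<in>S. orthogonal (v - p) z))"

abbreviation projN :: "('a::euclidean_space \<Rightarrow> 'a) \<Rightarrow> 'a \<Rightarrow> 'a \<Rightarrow> 'a" where
  "projN f xstar \<equiv> orth_proj (nullsp (fderiv f xstar))"

abbreviation projR :: "('a::euclidean_space \<Rightarrow> 'a) \<Rightarrow> 'a \<Rightarrow> 'a \<Rightarrow> 'a" where
  "projR f xstar \<equiv> orth_proj (rangesp (fderiv f xstar))"

definition Dhat :: "('a::euclidean_space \<Rightarrow> 'a) \<Rightarrow> 'a \<Rightarrow> 'a \<Rightarrow> 'a \<Rightarrow> 'a" where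
  "Dhat f xstar \<phi> v = projN f xstar (fderiv (fderiv f) xstar \<phi> (projN f xstar v))"

subsection \<open>The adaptive safeguarded Newton-Anderson iteration\<close>

text \<open>
  All sequences carry the index of the source: \<open>wstep f x k\<close> is w_k, for \<open>k \<ge> 1\<close>, and
  \<open>na_gamma\<close>, \<open>na_eta\<close>, \<open>na_beta\<close>, \<open>na_lambda\<close>, \<open>na_theta\<close> are used for \<open>k \<ge> 2\<close>, so the truncated
  subtractions below are genuine. \<open>inv\<close> is the inverse operator only when f'(x_(k-1)) is bijective.
\<close>

definition wstep :: "('a::euclidean_space \<Rightarrow> 'a) \<Rightarrow> (nat \<Rightarrow> 'a) \<Rightarrow> nat \<Rightarrow> 'a" where
  "wstep f x k = - inv (blinfun_apply (fderiv f (x (k - 1)))) (f (x (k - 1)))"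

definition na_gamma :: "('a::euclidean_space \<Rightarrow> 'a) \<Rightarrow> (nat \<Rightarrow> 'a) \<Rightarrow> nat \<Rightarrow> real" where
  "na_gamma f x k =
     ((wstep f x k - wstep f x (k - 1)) \<bullet> wstep f x k) / (norm (wstep f x k - wstep f x (k - 1)))\<^sup>2"

definition na_eta :: "('a::euclidean_space \<Rightarrow> 'a) \<Rightarrow> (nat \<Rightarrow> 'a) \<Rightarrow> nat \<Rightarrow> real" where
  "na_eta f x k = norm (wstep f x k) / norm (wstep f x (k - 1))"

definition na_beta :: "('a::euclidean_space \<Rightarrow> 'a) \<Rightarrow> real \<Rightarrow> (nat \<Rightarrow> 'a) \<Rightarrow> nat \<Rightarrow> real" where
  "na_beta f rhat x k = min (na_eta f x k) rhat * na_eta f x k"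

definition na_lambda :: "('a::euclidean_space \<Rightarrow> 'a) \<Rightarrow> real \<Rightarrow> (nat \<Rightarrow> 'a) \<Rightarrow> nat \<Rightarrow> real" where
  "na_lambda f rhat x k =
     (let \<gamma> = na_gamma f x k; \<beta> = na_beta f rhat x k in
      if \<gamma> = 0 \<or> \<gamma> \<ge> 1 then 0
      else if \<bar>\<gamma>\<bar> / \<bar>1 - \<gamma>\<bar> > \<beta> then \<beta> / (\<gamma> * (\<beta> + sgn \<gamma>))
      else 1)"

definition na_theta :: "('a::euclidean_space \<Rightarrow> 'a) \<Rightarrow> real \<Rightarrow> (nat \<Rightarrow> 'a) \<Rightarrow> nat \<Rightarrow> real" where
  "na_theta f rhat x k =
     norm (wstep f x k - (na_lambda f rhat x k * na_gamma f x k) *\<^sub>R (wstep f x k - wstep f x (k - 1)))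
       / norm (wstep f x k)"

text \<open>
  Since HOL functions are total, every \<open>x 0\<close> extends to exactly one such sequence; that none of the
  operations degenerates along the way has to be stated separately.
\<close>

definition newton_anderson ::
  "('a::euclidean_space \<Rightarrow> 'a) \<Rightarrow> real \<Rightarrow> (nat \<Rightarrow> 'a) \<Rightarrow> bool" where
  "newton_anderson f rhat x \<longleftrightarrow>
     x 1 = x 0 + wstep f x 1 \<and>
     (\<forall>k\<ge>1. x (k + 1) = x k + wstep f x (k + 1)
        - (na_lambda f rhat x (k + 1) * na_gamma f x (k + 1))
            *\<^sub>R (x k - x (k - 1) + wstep f x (k + 1) - wstep f x k))"

text \<open>
  \<open>iter_ok f xstar x\<close> says that every inverse and every quotient occurring in the iteration and in
  \<open>\<sigma>\<close> and \<open>\<theta>\<close> is a genuine one. (The denominators in \<open>na_lambda\<close> are nonzero in the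
  branches where they are used.)
\<close>

definition iter_ok :: "('a::euclidean_space \<Rightarrow> 'a) \<Rightarrow> 'a \<Rightarrow> (nat \<Rightarrow> 'a) \<Rightarrow> bool" where
  "iter_ok f xstar x \<longleftrightarrow>
     (\<forall>k. bij (blinfun_apply (fderiv f (x k)))) \<and>
     (\<forall>k. projN f xstar (x k - xstar) \<noteq> 0) \<and>
     (\<forall>k\<ge>1. wstep f x k \<noteq> 0 \<and> wstep f x (k + 1) \<noteq> wstep f x k)"

subsection \<open>The regions\<close>

definition sig :: "('a::euclidean_space \<Rightarrow> 'a) \<Rightarrow> 'a \<Rightarrow> (nat \<Rightarrow> 'a) \<Rightarrow> nat \<Rightarrow> real" where
  "sig f xstar x k = norm (projR f xstar (x k - xstar)) / norm (projN f xstar (x k - xstar))"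

definition region :: "('a::euclidean_space \<Rightarrow> 'a) \<Rightarrow> 'a \<Rightarrow> real \<Rightarrow> real \<Rightarrow> 'a set" where
  "region f xstar \<rho> \<sigma> =
     ball xstar \<rho> \<inter> {y. norm (projR f xstar (y - xstar)) < \<sigma> * norm (projN f xstar (y - xstar))}"

definition W :: "('a::euclidean_space \<Rightarrow> 'a) \<Rightarrow> 'a \<Rightarrow> (nat \<Rightarrow> 'a) \<Rightarrow> nat \<Rightarrow> 'a set" where
  "W f xstar x k = region f xstar (norm (x k - xstar)) (sig f xstar x k)"

end

theory Submission
  imports Defs
begin

text \<open>
  Write \<open>e = x - x*\<close>, let \<open>q\<close> be a unit vector spanning the null space \<open>N\<close> of \<open>A = f'(x*)\<close> and let
  \<open>B = f''(x*)\<close>. Since the range \<open>R\<close> of \<open>A\<close> is the orthogonal complement of \<open>N\<close>, the two projections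
  are \<open>v \<mapsto> (v \<bullet> q) q\<close> and its complement, and invertibility of the operator on \<open>N\<close> says that
  \<open>B(q,q) \<bullet> q \<noteq> 0\<close>.

  The Newton step. Near \<open>x*\<close> and in a narrow cone around \<open>N\<close>, the derivative \<open>f'(x) = A + B(e,\<sqdot>) + o(e)\<close>
  is invertible: on \<open>R\<close> through \<open>A\<close>, with bounded inverse, and on \<open>N\<close> through \<open>B(e,\<sqdot>)\<close>, with an inverse
  of order \<open>1/\<bar>e \<bullet> q\<bar>\<close> (\<open>inverse_bound\<close>). Applying \<open>f'(x)\<close> to the deviation of \<open>e + w\<close> from half
  the null component of \<open>e\<close> leaves an arbitrarily small multiple of \<open>\<parallel>e\<parallel>\<^sup>2\<close>. So \<open>e + w\<close> has an \<open>R\<close>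
  component of order \<open>\<parallel>e\<parallel>\<^sup>2\<close> and its \<open>N\<close> component is almost \<open>e \<bullet> q / 2\<close>; equivalently, it is almost
  that of \<open>-w\<close> (\<open>newton_step_near_singular_root\<close>).

  The Anderson step. With \<open>\<alpha> = \<lambda>\<gamma>\<close>, the new error is \<open>(1 - \<alpha>)(e' + w') + \<alpha>(e + w)\<close>, where
  \<open>e, w\<close> are the older and \<open>e', w'\<close> the newer error and step. This immediately bounds its
  \<open>R\<close> component. Its \<open>N\<close> component is almost that of \<open>-v\<close>, where \<open>v = (1 - \<alpha>) w' + \<alpha> w\<close> is the vector
  whose length defines \<open>\<theta>\<close>; since \<open>\<parallel>w'\<parallel>\<close> is about \<open>\<bar>e' \<bullet> q\<bar> / 2\<close>, the new \<open>N\<close> component is at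
  most about \<open>\<theta>/2\<close> times the old one. The approximations are relative to \<open>\<bar>1 - \<alpha>\<bar> \<parallel>w'\<parallel> + \<bar>\<alpha>\<bar> \<parallel>w\<parallel>\<close>,
  and the danger is that the two terms of \<open>v\<close> cancel. The safeguard excludes this: it
  forces \<open>\<bar>\<alpha>\<bar> \<parallel>w\<parallel> \<le> r \<bar>1 - \<alpha>\<bar> \<parallel>w'\<parallel>\<close> with \<open>r < 1\<close> (\<open>safeguard\<close>). The same inequality
  bounds the new \<open>N\<close> component from below by a multiple of \<open>\<bar>1 - \<alpha>\<bar> \<parallel>w'\<parallel>\<close>, while the new \<open>R\<close>
  component is at most \<open>\<bar>1 - \<alpha>\<bar> \<parallel>w'\<parallel>\<close> times the size of the previous errors, up to a constant.
  Hence every new \<open>\<sigma>\<close> is at most a constant times the previous errors (\<open>anderson_step\<close>).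

  Convergence. The safeguard also gives \<open>\<lambda> \<in> [0,1]\<close>, so \<open>\<theta> \<le> 1\<close>. By induction all iterates stay
  in the cone, \<open>\<bar>e \<bullet> q\<bar>\<close> decreases by a factor \<open>3/4\<close> each time, and \<open>\<sigma>\<^sub>k \<le> M \<parallel>e\<^sub>0\<parallel>\<close> for \<open>k \<ge> 1\<close>
  (\<open>anderson_invariant\<close>). Once a lower bound \<open>\<sigma> \<le> \<sigma>\<^sub>0\<close> is prescribed, starting within \<open>\<sigma>/M\<close> of
  \<open>x*\<close> makes all later \<open>\<sigma>\<^sub>k\<close> at most \<open>\<sigma>\<^sub>0\<close>, which is what the inclusion of the regions in the
  first one needs.
\<close>

section \<open>Null and range components\<close>

definition perp :: "'a::real_inner \<Rightarrow> 'a \<Rightarrow> 'a" where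
  "perp q v = v - (v \<bullet> q) *\<^sub>R q"

lemma perp_add: "perp q (u + v) = perp q u + perp q v"
  and perp_diff: "perp q (u - v) = perp q u - perp q v"
  and perp_scaleR: "perp q (c *\<^sub>R v) = c *\<^sub>R perp q v"
  by (simp_all add: perp_def algebra_simps)

lemma perp_self: "norm q = 1 \<Longrightarrow> perp q q = 0"
  by (simp add: perp_def dot_square_norm)

lemma abs_inner_unit_le: "norm q = 1 \<Longrightarrow> \<bar>v \<bullet> q\<bar> \<le> norm v"
  using Cauchy_Schwarz_ineq2[of v q] by simp

lemma norm_le_components: "norm q = 1 \<Longrightarrow> norm v \<le> \<bar>v \<bullet> q\<bar> + norm (perp q v)"
  using norm_triangle_ineq[of "(v \<bullet> q) *\<^sub>R q" "perp q v"] by (simp add: perp_def)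

lemma orth_proj_eqI:
  assumes "subspace S" "p \<in> S" "\<And>z. z \<in> S \<Longrightarrow> orthogonal (v - p) z"
  shows "orth_proj S v = p"
  unfolding orth_proj_def
proof (rule the_equality)
  fix p' assume p': "p' \<in> S \<and> (\<forall>z\<in>S. orthogonal (v - p') z)"
  have "p - p' \<in> S" using assms p' by (simp add: subspace_diff)
  then have "(v - p) \<bullet> (p - p') = 0" "(v - p') \<bullet> (p - p') = 0"
    using assms(3) p' by (auto simp: orthogonal_def)
  then have "(p - p') \<bullet> (p - p') = 0" by (simp add: algebra_simps)
  then show "p' = p" by simp
qed (use assms in auto)

text \<open>
  The range lies in the hyperplane orthogonal to \<open>q\<close>, and \<open>A\<close> maps this hyperplane injectively into
  itself, hence onto. Injectivity in finite dimension also gives the lower bound.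
\<close>

lemma orth_range_of_line_kernel:
  fixes A :: "'a::euclidean_space \<Rightarrow>\<^sub>L 'a"
  assumes orth: "\<forall>u\<in>rangesp A. \<forall>v\<in>nullsp A. orthogonal u v"
    and ker: "nullsp A = span {q}" and q: "norm q = 1"
  shows "rangesp A = {v. q \<bullet> v = 0}"
    and "\<exists>c>0. \<forall>u. c * norm (perp q u) \<le> norm (A u)"
proof -
  let ?H = "{v. q \<bullet> v = 0}"
  have Aq: "A q = 0"
  proof -
    have "q \<in> nullsp A" by (simp add: ker span_base)
    then show ?thesis by (simp add: nullsp_def)
  qed
  have ortho: "A u \<bullet> q = 0" for u
    using orth Aq by (auto simp: rangesp_def nullsp_def orthogonal_def)
  have sub: "subspace ?H" by (rule subspace_hyperplane)
  have inj0: "x = 0" if "x \<in> ?H" "A x = 0" for x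
  proof -
    have "x \<in> nullsp A" using that by (simp add: nullsp_def)
    then have "x \<in> span {q}" by (simp only: ker)
    then obtain t where "x = t *\<^sub>R q" by (auto simp: span_singleton)
    with that q show ?thesis by (simp add: dot_square_norm)
  qed
  have AH: "A ` ?H \<subseteq> ?H" using ortho by (auto simp: inner_commute)
  have lin: "linear (blinfun_apply A)"
    using blinfun.bounded_linear_right bounded_linear.linear by blast
  have "inj_on (blinfun_apply A) ?H"
    using inj0 lin sub by (simp add: linear_inj_on_iff_eq_0 linear_injective_on_subspace_0)
  then have "dim (A ` ?H) = dim ?H"
    using lin sub by (metis dim_image_eq span_eq_iff)
  then have "A ` ?H = ?H"
    using subspace_dim_equal[OF linear_subspace_image[OF lin sub] sub AH] by simp
  moreover have "rangesp A \<subseteq> ?H" using ortho by (auto simp: rangesp_def inner_commute)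
  moreover have "A ` ?H \<subseteq> rangesp A" by (auto simp: rangesp_def)
  ultimately show "rangesp A = ?H" by simp
  obtain c where c: "c > 0" "\<And>x. x \<in> ?H \<Longrightarrow> norm (A x) \<ge> c * norm x"
    using injective_imp_isometric[OF closed_hyperplane sub blinfun.bounded_linear_right[of A]] inj0
    by blast
  have "c * norm (perp q u) \<le> norm (A u)" for u
  proof -
    have "perp q u \<in> ?H" using q by (simp add: perp_def algebra_simps dot_square_norm inner_commute)
    then show ?thesis using c(2)[of "perp q u"] Aq
      by (simp add: perp_def blinfun.diff_right blinfun.scaleR_right)
  qed
  with c(1) show "\<exists>c>0. \<forall>u. c * norm (perp q u) \<le> norm (A u)" by blast
qed

section \<open>Expansion to second order\<close>

lemma has_derivative_fderiv:
  "f differentiable at x \<Longrightarrow> (f has_derivative blinfun_apply (fderiv f x)) (at x)"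
  by (metis bounded_linear_Blinfun_apply fderiv_def frechet_derivative_works has_derivative_bounded_linear)

text \<open>
  The estimate for \<open>f\<close> follows from the one for \<open>f'\<close> by the mean value inequality along the segment
  from \<open>p\<close> to \<open>p + e\<close>: the derivative of \<open>t \<mapsto> f (p + t e) - t A e - t\<^sup>2 B(e,e) / 2\<close> is the remainder
  of \<open>f'\<close> at \<open>p + t e\<close>, applied to \<open>e\<close>.
\<close>

lemma second_order_expansion:
  fixes f :: "'a::euclidean_space \<Rightarrow> 'b::euclidean_space"
  assumes f: "\<And>x. f differentiable at x" and f': "fderiv f differentiable at p" and "\<epsilon> > 0"
  shows "\<exists>\<rho>>0. \<forall>e. norm e < \<rho> \<longrightarrow>
     norm (fderiv f (p + e) - fderiv f p - fderiv (fderiv f) p e) \<le> \<epsilon> * norm e \<and>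
     norm (f (p + e) - f p - fderiv f p e - (1/2) *\<^sub>R fderiv (fderiv f) p e e) \<le> \<epsilon> * (norm e)\<^sup>2"
proof -
  let ?A = "fderiv f p" and ?B = "fderiv (fderiv f) p"
  obtain \<rho> where \<rho>: "\<rho> > 0"
    and lin: "\<And>y. norm (y - p) < \<rho> \<Longrightarrow>
       norm (fderiv f y - ?A - ?B (y - p)) \<le> \<epsilon> * norm (y - p)"
    using has_derivative_fderiv[OF f'] \<open>\<epsilon> > 0\<close> unfolding has_derivative_at_alt by blast
  have "norm (f (p + e) - f p - ?A e - (1/2) *\<^sub>R ?B e e) \<le> \<epsilon> * (norm e)\<^sup>2" if e: "norm e < \<rho>" for e
  proof -
    define h where "h t = f (p + t *\<^sub>R e) - t *\<^sub>R ?A e - (t\<^sup>2/2) *\<^sub>R ?B e e" for t :: real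
    define h' where "h' t = fderiv f (p + t *\<^sub>R e) e - ?A e - t *\<^sub>R ?B e e" for t :: real
    have der: "(h has_derivative (\<lambda>s. s *\<^sub>R h' t)) (at t within {0..1})" for t
    proof -
      have 1: "((\<lambda>t. f (p + t *\<^sub>R e)) has_derivative (\<lambda>s. fderiv f (p + t *\<^sub>R e) (s *\<^sub>R e))) (at t within {0..1})"
        by (rule has_derivative_compose[where g = f and f = "\<lambda>t. p + t *\<^sub>R e",
              OF _ has_derivative_fderiv[OF f]])
           (auto intro!: derivative_eq_intros)
      show ?thesis unfolding h_def h'_def
        by (auto intro!: derivative_eq_intros 1 simp: blinfun.scaleR_right algebra_simps)
    qed
    have bound: "norm (h' t) \<le> \<epsilon> * (norm e)\<^sup>2" if t: "t \<in> {0..1}" for t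
    proof -
      let ?G = "fderiv f (p + t *\<^sub>R e) - ?A - ?B (t *\<^sub>R e)"
      have te: "norm (t *\<^sub>R e) \<le> norm e" using t by (simp add: mult_left_le_one_le)
      have "norm ?G \<le> \<epsilon> * norm (t *\<^sub>R e)" using lin[of "p + t *\<^sub>R e"] te e by simp
      also have "\<dots> \<le> \<epsilon> * norm e" using te \<open>\<epsilon> > 0\<close> by simp
      finally have "norm (?G e) \<le> \<epsilon> * norm e * norm e"
        using norm_blinfun[of ?G e] by (meson mult_right_mono norm_ge_zero order_trans)
      then show ?thesis
        by (simp add: h'_def blinfun.diff_left blinfun.scaleR_right blinfun.scaleR_left power2_eq_square mult.assoc)
    qed
    have "norm (h 1 - h 0) \<le> \<epsilon> * (norm e)\<^sup>2 * norm (1 - 0 :: real)"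
    proof (rule differentiable_bound[where S = "{0..1::real}" and f' = "\<lambda>t s. s *\<^sub>R h' t"])
      show "onorm (\<lambda>s. s *\<^sub>R h' t) \<le> \<epsilon> * (norm e)\<^sup>2" if "t \<in> {0..1}" for t
        using bound[OF that] by (intro onorm_le) (simp add: mult.commute mult_left_mono)
    qed (use der in auto)
    then show ?thesis by (simp add: h_def algebra_simps)
  qed
  moreover have "norm (fderiv f (p + e) - ?A - ?B e) \<le> \<epsilon> * norm e" if "norm e < \<rho>" for e
    using lin[of "p + e"] that by simp
  ultimately show ?thesis using \<rho> by blast
qed

section \<open>The Newton step near the singular root\<close>

text \<open>
  Split \<open>G u\<close> into its range and null components. The range component is dominated by \<open>A u\<close>, which
  controls \<open>perp q u\<close>; the null component is dominated by \<open>(e \<bullet> q)(u \<bullet> q) B(q,q) \<bullet> q\<close>, which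
  controls \<open>(e \<bullet> q)(u \<bullet> q)\<close>. For small \<open>\<delta>\<close> the cross terms are absorbed when the second bound
  is inserted into the first.
\<close>

lemma inverse_bound:
  fixes A :: "'a::euclidean_space \<Rightarrow>\<^sub>L 'a" and B :: "'a \<Rightarrow>\<^sub>L 'a \<Rightarrow>\<^sub>L 'a"
  assumes q: "norm q = 1" and ortho: "\<And>u. A u \<bullet> q = 0"
    and c: "c > 0" "\<And>u. c * norm (perp q u) \<le> norm (A u)"
    and nondeg: "B q q \<bullet> q \<noteq> 0"
  shows "\<exists>C>0. \<exists>\<delta>>0. \<forall>G e u. norm (perp q e) \<le> \<delta> * \<bar>e \<bullet> q\<bar> \<longrightarrow> \<bar>e \<bullet> q\<bar> \<le> \<delta> \<longrightarrow>
      norm (G - A - B e) \<le> \<delta> * norm e \<longrightarrow>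
      norm (perp q u) \<le> C * norm (blinfun_apply G u) \<and> \<bar>e \<bullet> q\<bar> * \<bar>u \<bullet> q\<bar> \<le> C * norm (blinfun_apply G u)"
proof -
  \<comment> \<open>The middle entry of \<open>\<delta>\<close> absorbs the cross terms of the null component, the last one those
     of the range component; \<open>C0\<close> and \<open>C1\<close> are what remains after the absorption.\<close>
  define d where "d = \<bar>B q q \<bullet> q\<bar>"
  define K where "K = norm B + 1"
  define L where "L = 2 * (K + 1)"
  define C0 where "C0 = (2 / c) * (1 + L * 2 / d)"
  define C1 where "C1 = (2 / d) * (1 + 2 * K * C0)"
  define Q where "Q = L * (1 + 4 * K / d)"
  define \<delta> where "\<delta> = min 1 (min (d / (2 * (2 + K))) (c / (2 * Q)))"
  have d: "d > 0" using nondeg by (simp add: d_def)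
  have K: "K \<ge> 1" by (simp add: K_def)
  have L: "L > 0" using K by (simp add: L_def)
  have C0: "C0 > 0" using c d L by (simp add: C0_def add_pos_pos)
  have C1: "C1 > 0" using C0 d K by (simp add: C1_def add_pos_nonneg)
  have Q: "Q > 0" using L K d by (simp add: Q_def add_pos_nonneg)
  have \<delta>: "\<delta> > 0" "\<delta> \<le> 1" using d c Q K by (simp_all add: \<delta>_def)
  have \<delta>d: "(2 + K) * \<delta> \<le> d / 2"
  proof -
    have "\<delta> \<le> d / (2 * (2 + K))" by (simp add: \<delta>_def)
    then show ?thesis using K by (simp add: field_simps)
  qed
  have \<delta>c: "Q * \<delta> \<le> c / 2"
  proof -
    have "\<delta> \<le> c / (2 * Q)" by (simp add: \<delta>_def)
    then show ?thesis using Q by (simp add: field_simps)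
  qed
  have Bn: "norm (B y z) \<le> K * norm y * norm z" for y z
  proof -
    have "norm (B y z) \<le> norm (B y) * norm z" by (rule norm_blinfun)
    also have "\<dots> \<le> norm B * norm y * norm z" by (simp add: mult_right_mono norm_blinfun)
    also have "\<dots> \<le> K * norm y * norm z" by (simp add: K_def mult_right_mono)
    finally show ?thesis .
  qed
  have dK: "d \<le> K"
    using abs_inner_unit_le[OF q, of "B q q"] Bn[of q q] q by (simp add: d_def)
  have main: "norm (perp q u) \<le> C0 * norm (G u) \<and> \<bar>e \<bullet> q\<bar> * \<bar>u \<bullet> q\<bar> \<le> C1 * norm (G u)"
    if er: "norm (perp q e) \<le> \<delta> * \<bar>e \<bullet> q\<bar>" and a: "\<bar>e \<bullet> q\<bar> \<le> \<delta>"
      and G: "norm (G - A - B e) \<le> \<delta> * norm e" for G e u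
  proof -
    define a where "a = \<bar>e \<bullet> q\<bar>"
    define s where "s = \<bar>u \<bullet> q\<bar>"
    define r where "r = norm (perp q u)"
    define g where "g = norm (G u)"
    define E where "E = (G - A - B e) u"
    have nn: "a \<ge> 0" "s \<ge> 0" "r \<ge> 0" "g \<ge> 0" by (simp_all add: a_def s_def r_def g_def)
    have u: "norm u \<le> s + r" using norm_le_components[OF q, of u] by (simp add: s_def r_def)
    have "\<delta> * a \<le> 1 * a" using \<delta> nn by (intro mult_right_mono) auto
    then have e: "norm e \<le> 2 * a"
      using norm_le_components[OF q, of e] er by (simp add: a_def)
    have "norm E \<le> \<delta> * norm e * norm u"
      unfolding E_def by (meson G mult_right_mono norm_blinfun norm_ge_zero order_trans)
    also have "\<dots> \<le> \<delta> * (2 * a) * (s + r)"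
      using e u \<delta> nn by (intro mult_mono) auto
    finally have E: "norm E \<le> 2 * \<delta> * a * (s + r)" by simp
    have Gu: "G u = A u + B e u + E" by (simp add: E_def blinfun.diff_left)
    \<comment> \<open>The range component of the equation.\<close>
    have "norm (A u) \<le> g + norm (B e u) + norm E"
      using Gu norm_triangle_ineq4[of "G u" "B e u + E"] norm_triangle_ineq[of "B e u" E]
      by (simp add: g_def)
    also have "norm (B e u) \<le> K * (2 * a) * (s + r)"
      using e u K nn by (intro order_trans[OF Bn] mult_mono) auto
    also have "norm E \<le> 2 * a * (s + r)"
    proof -
      have "2 * \<delta> * a * (s + r) = \<delta> * (2 * a * (s + r))" by simp
      also have "\<dots> \<le> 1 * (2 * a * (s + r))" using \<delta> nn by (intro mult_right_mono) auto
      finally show ?thesis using E by simp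
    qed
    finally have R: "c * r \<le> g + L * (a * (s + r))"
      using c(2)[of u] by (simp add: r_def L_def algebra_simps)
    \<comment> \<open>The kernel component of the equation.\<close>
    have dec: "B e u = ((e \<bullet> q) * (u \<bullet> q)) *\<^sub>R B q q + (e \<bullet> q) *\<^sub>R B q (perp q u) + B (perp q e) u"
      by (simp add: perp_def blinfun.diff_left blinfun.diff_right blinfun.scaleR_left
          blinfun.scaleR_right algebra_simps)
    have "((e \<bullet> q) * (u \<bullet> q)) * (B q q \<bullet> q) =
        G u \<bullet> q - (e \<bullet> q) * (B q (perp q u) \<bullet> q) - B (perp q e) u \<bullet> q - E \<bullet> q"
      using Gu dec ortho[of u] by (simp add: inner_add_left)
    then have "a * s * d \<le> \<bar>G u \<bullet> q\<bar> + \<bar>(e \<bullet> q) * (B q (perp q u) \<bullet> q)\<bar> + \<bar>B (perp q e) u \<bullet> q\<bar> + \<bar>E \<bullet> q\<bar>"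
      unfolding a_def s_def d_def abs_mult[symmetric] by linarith
    also have "\<bar>G u \<bullet> q\<bar> \<le> g" unfolding g_def by (rule abs_inner_unit_le[OF q])
    also have "\<bar>(e \<bullet> q) * (B q (perp q u) \<bullet> q)\<bar> \<le> a * (K * r)"
      using order_trans[OF abs_inner_unit_le[OF q] Bn[of q "perp q u"]] q
      by (simp add: abs_mult a_def r_def mult_left_mono)
    also have "\<bar>B (perp q e) u \<bullet> q\<bar> \<le> K * (\<delta> * a) * (s + r)"
    proof -
      have "\<bar>B (perp q e) u \<bullet> q\<bar> \<le> K * norm (perp q e) * norm u"
        using order_trans[OF abs_inner_unit_le[OF q] Bn] .
      also have "\<dots> \<le> K * (\<delta> * a) * (s + r)"
        using er u K nn \<delta> by (intro mult_mono) (auto simp: a_def)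
      finally show ?thesis .
    qed
    also have "\<bar>E \<bullet> q\<bar> \<le> 2 * \<delta> * a * (s + r)"
      using order_trans[OF abs_inner_unit_le[OF q] E] .
    finally have "a * s * d \<le> g + K * a * r + (2 + K) * \<delta> * (a * (s + r))"
      by (simp add: algebra_simps)
    also have "(2 + K) * \<delta> * (a * (s + r)) \<le> (d / 2) * (a * (s + r))"
      using \<delta>d nn by (intro mult_right_mono) auto
    finally have "(d / 2) * (a * s) \<le> g + (K + d / 2) * (a * r)"
      by (simp add: algebra_simps)
    also have "(K + d / 2) * (a * r) \<le> 2 * K * (a * r)"
      using dK d nn by (intro mult_right_mono) auto
    finally have N: "a * s \<le> (2 / d) * (g + 2 * K * (a * r))"
      using d by (simp add: field_simps)
    have halve: "(c / 2) * r \<le> P" if "c * r \<le> P + (c / 2) * r" for P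
      using that by linarith
    have "c * r \<le> g + L * ((2 / d) * (g + 2 * K * (a * r)) + a * r)"
      using R mult_left_mono[OF N, of L] L by (simp add: distrib_left)
    also have "\<dots> = (1 + L * 2 / d) * g + Q * a * r"
      using d by (simp add: Q_def field_simps)
    also have "Q * a * r \<le> (c / 2) * r"
    proof -
      have "Q * a \<le> Q * \<delta>" using a Q by (simp add: a_def)
      then show ?thesis using \<delta>c nn by (intro mult_right_mono) auto
    qed
    finally have "c * r \<le> (1 + L * 2 / d) * g + (c / 2) * r" by simp
    then have "(c / 2) * r \<le> (1 + L * 2 / d) * g" by (rule halve)
    then have r: "r \<le> C0 * g" using c(1) by (simp add: C0_def field_simps)
    have "a * r \<le> 1 * r" using a \<delta> nn by (intro mult_right_mono) (auto simp: a_def)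
    then have "2 * K * (a * r) \<le> 2 * K * (C0 * g)"
      using r K by (intro mult_left_mono) auto
    then have "(2 / d) * (g + 2 * K * (a * r)) \<le> (2 / d) * (g + 2 * K * (C0 * g))"
      using d by (intro mult_left_mono) auto
    then have "a * s \<le> C1 * g"
      using N by (simp add: C1_def algebra_simps)
    with r show ?thesis by (simp add: a_def s_def r_def g_def)
  qed
  have "norm (perp q u) \<le> max C0 C1 * norm (G u) \<and> \<bar>e \<bullet> q\<bar> * \<bar>u \<bullet> q\<bar> \<le> max C0 C1 * norm (G u)"
    if "norm (perp q e) \<le> \<delta> * \<bar>e \<bullet> q\<bar>" and "\<bar>e \<bullet> q\<bar> \<le> \<delta>"
      and "norm (G - A - B e) \<le> \<delta> * norm e" for G e u
  proof -
    have "C0 * norm (G u) \<le> max C0 C1 * norm (G u)" "C1 * norm (G u) \<le> max C0 C1 * norm (G u)"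
      by (simp_all add: mult_right_mono)
    with main[OF that, of u] show ?thesis by (meson order_trans)
  qed
  then show ?thesis using \<delta>(1) C0 by (intro exI[of _ "max C0 C1"]) auto
qed

text \<open>
  The Newton step \<open>w\<close> at error \<open>e\<close> halves the component of the error along \<open>q\<close> up to the relative
  error \<open>\<epsilon>\<close>, points along \<open>q\<close> up to \<open>\<epsilon>\<close>, and is quadratically accurate across \<open>q\<close>. The
  constant \<open>C\<close> is kept apart from \<open>\<epsilon>\<close> because the former is fixed by \<open>f\<close> before the latter is chosen.
\<close>

definition newton_estimate :: "'a::real_inner \<Rightarrow> real \<Rightarrow> real \<Rightarrow> 'a \<Rightarrow> 'a \<Rightarrow> bool" where
  "newton_estimate q C \<epsilon> e w \<longleftrightarrow>
     e \<bullet> q \<noteq> 0 \<and> norm e \<le> 2 * \<bar>e \<bullet> q\<bar> \<and>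
     \<bar>2 * (w \<bullet> q) + e \<bullet> q\<bar> \<le> \<epsilon> * \<bar>e \<bullet> q\<bar> \<and>
     norm (perp q w) \<le> \<epsilon> * \<bar>e \<bullet> q\<bar> \<and>
     norm (perp q (e + w)) \<le> C * (norm e)\<^sup>2"

text \<open>
  The deviation \<open>u = e + w - (e \<bullet> q / 2) q\<close> of the Newton update from half the null component
  satisfies \<open>f'(x) u = o(\<parallel>e\<parallel>\<^sup>2) + B(e, perp q e) / 2\<close>, because \<open>f'(x) w = - f x\<close>. In the cone the
  last term is at most a small multiple of \<open>\<parallel>e\<parallel>\<^sup>2\<close> too, and \<open>inverse_bound\<close> turns this into
  bounds for both components of \<open>u\<close>.
\<close>

lemma newton_step_near_singular_root:
  fixes f :: "'a::euclidean_space \<Rightarrow> 'a"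
  assumes f: "\<And>x. f differentiable at x" and f': "fderiv f differentiable at p" and zero: "f p = 0"
    and q: "norm q = 1" and Aq: "fderiv f p q = 0" and ortho: "\<And>u. fderiv f p u \<bullet> q = 0"
    and c: "c > 0" "\<And>u. c * norm (perp q u) \<le> norm (fderiv f p u)"
    and nondeg: "fderiv (fderiv f) p q q \<bullet> q \<noteq> 0"
  shows "\<exists>C>0. \<forall>\<epsilon>>0. \<exists>\<tau>>0. \<forall>x. (x - p) \<bullet> q \<noteq> 0 \<longrightarrow>
      norm (perp q (x - p)) \<le> \<tau> * \<bar>(x - p) \<bullet> q\<bar> \<longrightarrow> norm (x - p) < \<tau> \<longrightarrow>
      bij (blinfun_apply (fderiv f x)) \<and>
      newton_estimate q C \<epsilon> (x - p) (- inv (blinfun_apply (fderiv f x)) (f x))"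
proof -
  let ?A = "fderiv f p" and ?B = "fderiv (fderiv f) p"
  obtain C \<delta> where C: "C > 0" and \<delta>: "\<delta> > 0" and inv_bound:
    "\<And>G e u. norm (perp q e) \<le> \<delta> * \<bar>e \<bullet> q\<bar> \<Longrightarrow> \<bar>e \<bullet> q\<bar> \<le> \<delta> \<Longrightarrow>
        norm (G - ?A - ?B e) \<le> \<delta> * norm e \<Longrightarrow>
        norm (perp q u) \<le> C * norm (blinfun_apply G u) \<and> \<bar>e \<bullet> q\<bar> * \<bar>u \<bullet> q\<bar> \<le> C * norm (blinfun_apply G u)"
    using inverse_bound[OF q ortho c nondeg] by metis
  define K where "K = 3 + norm ?B"
  have K: "K \<ge> 3" by (simp add: K_def)
  have "\<exists>\<tau>>0. \<forall>x. (x - p) \<bullet> q \<noteq> 0 \<longrightarrow>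
      norm (perp q (x - p)) \<le> \<tau> * \<bar>(x - p) \<bullet> q\<bar> \<longrightarrow> norm (x - p) < \<tau> \<longrightarrow>
      bij (blinfun_apply (fderiv f x)) \<and>
      newton_estimate q C \<epsilon> (x - p) (- inv (blinfun_apply (fderiv f x)) (f x))" if "\<epsilon> > 0" for \<epsilon>
  proof -
    \<comment> \<open>With \<open>\<mu>\<close> as accuracy of the expansion and as slope of the cone, \<open>f'(x) u\<close> is at most
       \<open>\<mu> K \<parallel>e\<parallel>\<^sup>2\<close>; the choice makes \<open>\<mu> K \<le> 1\<close> and \<open>8 C \<mu> K + \<mu> \<le> \<epsilon>\<close>.\<close>
    define \<mu> where "\<mu> = min \<delta> (min (1 / K) (\<epsilon> / (8 * C * K + 1)))"
    have CK: "8 * C * K + 1 > 0" using C K by (simp add: add_pos_pos)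
    have \<mu>: "\<mu> > 0" "\<mu> \<le> \<delta>" using \<delta> K \<open>\<epsilon> > 0\<close> CK by (auto simp: \<mu>_def)
    have \<mu>K: "\<mu> * K \<le> 1"
    proof -
      have "\<mu> \<le> 1 / K" by (simp add: \<mu>_def)
      then show ?thesis using K by (simp add: field_simps)
    qed
    have \<mu>1: "\<mu> \<le> 1"
    proof -
      have "\<mu> * 1 \<le> \<mu> * K" using \<mu> K by (intro mult_left_mono) auto
      with \<mu>K show ?thesis by simp
    qed
    have \<mu>\<epsilon>: "8 * C * (\<mu> * K) + \<mu> \<le> \<epsilon>"
    proof -
      have "\<mu> \<le> \<epsilon> / (8 * C * K + 1)" by (simp add: \<mu>_def)
      then show ?thesis using CK by (simp add: field_simps)
    qed
    obtain \<rho> where \<rho>: "\<rho> > 0" and expand: "\<And>e. norm e < \<rho> \<Longrightarrow>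
        norm (fderiv f (p + e) - ?A - ?B e) \<le> \<mu> * norm e \<and>
        norm (f (p + e) - f p - ?A e - (1/2) *\<^sub>R ?B e e) \<le> \<mu> * (norm e)\<^sup>2"
      using second_order_expansion[OF f f' \<mu>(1)] by blast
    have "bij (blinfun_apply (fderiv f x)) \<and>
        newton_estimate q C \<epsilon> (x - p) (- inv (blinfun_apply (fderiv f x)) (f x))"
      if a0: "(x - p) \<bullet> q \<noteq> 0" and cone: "norm (perp q (x - p)) \<le> min \<mu> \<rho> * \<bar>(x - p) \<bullet> q\<bar>"
        and near: "norm (x - p) < min \<mu> \<rho>" for x
    proof -
      define e where "e = x - p"
      define a where "a = e \<bullet> q"
      let ?G = "fderiv f x"
      define E where "E = ?G - ?A - ?B e"
      define h where "h = f x - ?A e - (1/2) *\<^sub>R ?B e e"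
      have E: "norm E \<le> \<mu> * norm e" and h: "norm h \<le> \<mu> * (norm e)\<^sup>2"
        using expand[of e] near zero by (auto simp: e_def E_def h_def)
      have er: "norm (perp q e) \<le> \<mu> * \<bar>a\<bar>"
        using cone mult_right_mono[of "min \<mu> \<rho>" \<mu> "\<bar>a\<bar>"] by (simp add: e_def a_def)
      have a_le: "\<bar>a\<bar> \<le> norm e" unfolding a_def by (rule abs_inner_unit_le[OF q])
      have a_pos: "\<bar>a\<bar> > 0" using a0 by (simp add: a_def e_def)
      have a\<mu>: "\<bar>a\<bar> \<le> \<mu>" using a_le near by (simp add: e_def)
      have e_le: "norm e \<le> 2 * \<bar>a\<bar>"
        using norm_le_components[OF q, of e] er mult_right_mono[OF \<mu>1, of "\<bar>a\<bar>"] by (simp add: a_def)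
      have bound: "norm (perp q u) \<le> C * norm (?G u)" "\<bar>a\<bar> * \<bar>u \<bullet> q\<bar> \<le> C * norm (?G u)" for u
      proof -
        have "norm (perp q e) \<le> \<delta> * \<bar>a\<bar>" "norm E \<le> \<delta> * norm e"
          using er E mult_right_mono[OF \<mu>(2), of "\<bar>a\<bar>"] mult_right_mono[OF \<mu>(2), of "norm e"]
          by (auto intro: order_trans)
        then show "norm (perp q u) \<le> C * norm (?G u)" "\<bar>a\<bar> * \<bar>u \<bullet> q\<bar> \<le> C * norm (?G u)"
          using inv_bound[of e ?G u] a\<mu> \<mu>(2) by (auto simp: a_def E_def)
      qed
      have lin: "linear (blinfun_apply ?G)"
        using blinfun.bounded_linear_right bounded_linear.linear by blast
      have "inj (blinfun_apply ?G)"
      proof (rule linear_injective_0[OF lin, THEN iffD2], intro allI impI)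
        fix u assume "?G u = 0"
        then have "norm (perp q u) \<le> 0" "\<bar>a\<bar> * \<bar>u \<bullet> q\<bar> \<le> 0" using bound[of u] by auto
        then have "perp q u = 0" "u \<bullet> q = 0" using a_pos by (auto simp: mult_le_0_iff)
        then show "u = 0" by (simp add: perp_def)
      qed
      then have bij: "bij (blinfun_apply ?G)"
        using lin by (simp add: bij_def linear_injective_imp_surjective)
      define w where "w = - inv (blinfun_apply ?G) (f x)"
      have Gw: "?G w = - f x"
        using bij by (simp add: w_def blinfun.minus_right bij_is_surj surj_f_inv_f)
      define u where "u = e + w - (a / 2) *\<^sub>R q"
      have Gu: "?G u = E (e - (a / 2) *\<^sub>R q) + (1/2) *\<^sub>R ?B e (perp q e) - h"
      proof -
        have "?B e e = a *\<^sub>R ?B e q + ?B e (perp q e)"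
          by (simp add: perp_def a_def blinfun.diff_right blinfun.scaleR_right)
        moreover have "?G e = ?A e + ?B e e + E e" "?G q = ?B e q + E q"
          using Aq by (simp_all add: E_def blinfun.diff_left)
        moreover have "f x = ?A e + (1/2) *\<^sub>R ?B e e + h" by (simp add: h_def)
        moreover have "?G u = ?G e - f x - (a / 2) *\<^sub>R ?G q"
          using Gw by (simp add: u_def blinfun.add_right blinfun.diff_right blinfun.scaleR_right)
        moreover have "E (e - (a / 2) *\<^sub>R q) = E e - (a / 2) *\<^sub>R E q"
          by (simp add: blinfun.diff_right blinfun.scaleR_right)
        moreover have "(v + (a *\<^sub>R z + y) + s) - (v + (1/2) *\<^sub>R (a *\<^sub>R z + y) + h) - (a / 2) *\<^sub>R (z + t)
            = (s - (a / 2) *\<^sub>R t) + (1/2) *\<^sub>R y - h" for v z y s t :: 'a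
          by (rule euclidean_eqI) (simp add: inner_add_left inner_diff_left algebra_simps)
        ultimately show ?thesis by (simp only:)
      qed
      have "norm (?G u) \<le> norm (E (e - (a / 2) *\<^sub>R q)) + norm ((1/2) *\<^sub>R ?B e (perp q e)) + norm h"
        unfolding Gu by (meson add_right_mono norm_triangle_ineq norm_triangle_ineq4 order_trans)
      also have "norm (E (e - (a / 2) *\<^sub>R q)) \<le> (\<mu> * norm e) * (2 * norm e)"
      proof -
        have "norm (e - (a / 2) *\<^sub>R q) \<le> norm e + \<bar>a\<bar> / 2"
          using norm_triangle_ineq4[of e "(a / 2) *\<^sub>R q"] q by simp
        also have "\<dots> \<le> 2 * norm e" using a_le by simp
        finally have "norm E * norm (e - (a / 2) *\<^sub>R q) \<le> (\<mu> * norm e) * (2 * norm e)"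
          using E \<mu> by (intro mult_mono) auto
        then show ?thesis using norm_blinfun[of E "e - (a / 2) *\<^sub>R q"] by linarith
      qed
      also have "norm ((1/2) *\<^sub>R ?B e (perp q e)) \<le> norm ?B * norm e * (\<mu> * norm e)"
      proof -
        have "norm ((1/2) *\<^sub>R ?B e (perp q e)) \<le> norm (?B e (perp q e))" by simp
        also have "\<dots> \<le> norm (?B e) * norm (perp q e)" by (rule norm_blinfun)
        also have "\<dots> \<le> (norm ?B * norm e) * (\<mu> * norm e)"
          using er order_trans[OF er, of "\<mu> * norm e"] mult_left_mono[OF a_le, of \<mu>] \<mu>
          by (intro mult_mono norm_blinfun) auto
        finally show ?thesis .
      qed
      also note h
      finally have Gu_le: "norm (?G u) \<le> (\<mu> * K) * (norm e)\<^sup>2"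
        by (simp add: K_def power2_eq_square algebra_simps)
      have CGu: "C * norm (?G u) \<le> (C * (\<mu> * K)) * (norm e)\<^sup>2"
        using Gu_le C by simp
      have ru: "perp q (e + w) = perp q u"
        by (simp add: u_def perp_diff perp_scaleR perp_self[OF q])
      have e2: "(norm e)\<^sup>2 \<le> 4 * \<bar>a\<bar> * \<bar>a\<bar>"
        using mult_mono[OF e_le e_le] by (simp add: power2_eq_square)
      have CKe2: "(C * (\<mu> * K)) * (norm e)\<^sup>2 \<le> (4 * C * (\<mu> * K)) * \<bar>a\<bar> * \<bar>a\<bar>"
        using mult_left_mono[OF e2, of "C * (\<mu> * K)"] C \<mu> K by (simp add: algebra_simps)
      have "\<bar>u \<bullet> q\<bar> * \<bar>a\<bar> \<le> ((4 * C * (\<mu> * K)) * \<bar>a\<bar>) * \<bar>a\<bar>"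
        using bound(2)[of u] CGu CKe2 by (simp add: mult.commute)
      then have uq: "\<bar>u \<bullet> q\<bar> \<le> (4 * C * (\<mu> * K)) * \<bar>a\<bar>"
        using a_pos by (rule mult_right_le_imp_le)
      have "2 * (w \<bullet> q) + a = 2 * (u \<bullet> q)"
        using q by (simp add: u_def a_def inner_diff_left inner_add_left dot_square_norm)
      then have "\<bar>2 * (w \<bullet> q) + a\<bar> \<le> (8 * C * (\<mu> * K)) * \<bar>a\<bar>" using uq by simp
      also have "\<dots> \<le> \<epsilon> * \<bar>a\<bar>" using \<mu>\<epsilon> \<mu> by (intro mult_right_mono) auto
      finally have 1: "\<bar>2 * (w \<bullet> q) + a\<bar> \<le> \<epsilon> * \<bar>a\<bar>" .
      have "norm (perp q u) \<le> (C * (\<mu> * K)) * (norm e)\<^sup>2" using bound(1)[of u] CGu by simp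
      moreover have "C * (\<mu> * K) \<le> C * 1" using C \<mu>K by (intro mult_left_mono) auto
      ultimately have 2: "norm (perp q (e + w)) \<le> C * (norm e)\<^sup>2"
        unfolding ru using mult_right_mono[of "C * (\<mu> * K)" C "(norm e)\<^sup>2"] by simp
      have "perp q w = perp q u - perp q e"
        using ru by (simp add: perp_add eq_diff_eq add.commute)
      then have "norm (perp q w) \<le> norm (perp q u) + norm (perp q e)"
        by (metis norm_triangle_ineq4)
      also have "\<dots> \<le> (4 * C * (\<mu> * K)) * \<bar>a\<bar> * \<bar>a\<bar> + \<mu> * \<bar>a\<bar>"
        using bound(1)[of u] CGu CKe2 er by linarith
      also have "\<dots> \<le> (4 * C * (\<mu> * K)) * \<bar>a\<bar> * 1 + \<mu> * \<bar>a\<bar>"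
        using a\<mu> \<mu>1 C \<mu> K by (intro add_mono mult_left_mono) auto
      also have "\<dots> = (4 * C * (\<mu> * K) + \<mu>) * \<bar>a\<bar>" by (simp add: algebra_simps)
      also have "\<dots> \<le> \<epsilon> * \<bar>a\<bar>"
      proof (rule mult_right_mono)
        have "0 \<le> C * (\<mu> * K)" using C \<mu> K by simp
        then show "4 * C * (\<mu> * K) + \<mu> \<le> \<epsilon>" using \<mu>\<epsilon> by simp
      qed simp
      finally have 3: "norm (perp q w) \<le> \<epsilon> * \<bar>a\<bar>" .
      have "newton_estimate q C \<epsilon> e w"
        using a_pos e_le 1 2 3 by (simp add: newton_estimate_def a_def)
      then show ?thesis using bij by (simp add: e_def w_def)
    qed
    moreover have "min \<mu> \<rho> > 0" using \<mu> \<rho> by simp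
    ultimately show ?thesis by blast
  qed
  with C show ?thesis by blast
qed

section \<open>The safeguard\<close>

text \<open>
  The nontrivial value of the relaxation is chosen to make \<open>\<bar>l \<gamma>\<bar> / \<bar>1 - l \<gamma>\<bar>\<close> equal to \<open>\<beta>\<close>; it
  replaces \<open>l = 1\<close> when the ratio would exceed \<open>\<beta>\<close> there, and this is why it is less than 1.
\<close>

lemma relaxation_bounds:
  fixes \<beta> \<gamma> :: real
  assumes "0 \<le> \<beta>" and neg: "\<gamma> < 0 \<Longrightarrow> \<beta> < 1"
  defines "l \<equiv> if \<gamma> = 0 \<or> \<gamma> \<ge> 1 then 0
               else if \<bar>\<gamma>\<bar> / \<bar>1 - \<gamma>\<bar> > \<beta> then \<beta> / (\<gamma> * (\<beta> + sgn \<gamma>)) else 1"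
  shows "0 \<le> l" "l \<le> 1" "\<bar>l * \<gamma>\<bar> \<le> \<beta> * \<bar>1 - l * \<gamma>\<bar>"
proof -
  consider "\<gamma> = 0 \<or> \<gamma> \<ge> 1" | "\<gamma> \<noteq> 0" "\<gamma> < 1" "\<bar>\<gamma>\<bar> / \<bar>1 - \<gamma>\<bar> \<le> \<beta>"
    | "0 < \<gamma>" "\<gamma> < 1" "\<beta> < \<bar>\<gamma>\<bar> / \<bar>1 - \<gamma>\<bar>" | "\<gamma> < 0" "\<beta> < \<bar>\<gamma>\<bar> / \<bar>1 - \<gamma>\<bar>"
    by linarith
  then have "0 \<le> l \<and> l \<le> 1 \<and> \<bar>l * \<gamma>\<bar> \<le> \<beta> * \<bar>1 - l * \<gamma>\<bar>"
  proof cases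
    case 1
    then show ?thesis using assms(1) by (auto simp: l_def)
  next
    case 2
    then have "l = 1" by (auto simp: l_def)
    moreover have "\<bar>\<gamma>\<bar> \<le> \<beta> * \<bar>1 - \<gamma>\<bar>" using 2 by (simp add: pos_divide_le_eq)
    ultimately show ?thesis by simp
  next
    case 3
    have l: "l = \<beta> / (\<gamma> * (\<beta> + 1))" using 3 by (simp add: l_def)
    have b: "\<beta> < \<gamma> * (\<beta> + 1)" using 3 by (simp add: field_simps)
    have lg: "l * \<gamma> = \<beta> / (\<beta> + 1)" using 3 by (simp add: l)
    have "1 - l * \<gamma> = 1 / (\<beta> + 1)" unfolding lg using assms(1) by (simp add: field_simps)
    then show ?thesis using b 3 assms(1) lg by (simp add: l)
  next
    case 4
    have \<beta>: "\<beta> < 1" using neg 4 by blast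
    have l: "l = \<beta> / (\<gamma> * (\<beta> - 1))" using 4 by (simp add: l_def)
    have b: "\<beta> < \<gamma> * (\<beta> - 1)" using 4 by (simp add: field_simps)
    have lg: "l * \<gamma> = - (\<beta> / (1 - \<beta>))" using 4 \<beta> by (simp add: l field_simps)
    have "1 - l * \<gamma> = 1 / (1 - \<beta>)" unfolding lg using \<beta> by (simp add: field_simps)
    then show ?thesis using b 4 assms(1) \<beta> lg by (simp add: l)
  qed
  then show "0 \<le> l" "l \<le> 1" "\<bar>l * \<gamma>\<bar> \<le> \<beta> * \<bar>1 - l * \<gamma>\<bar>" by auto
qed

text \<open>
  Since \<open>\<beta> \<le> r \<eta>\<close>, the bound on the ratio \<open>\<bar>\<alpha>\<bar> / \<bar>1 - \<alpha>\<bar>\<close> says that the old step contributes at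
  most the fraction \<open>r\<close> of what the new one does. For the second bound, \<open>\<gamma>\<close> minimises
  \<open>\<parallel>w - \<gamma> (w - w')\<parallel>\<close>, and moving from 0 a fraction \<open>\<lambda> \<in> [0,1]\<close> of the way to the minimiser of a
  convex function does not increase it.
\<close>

lemma safeguard:
  fixes f :: "'a::euclidean_space \<Rightarrow> 'a" and x :: "nat \<Rightarrow> 'a"
  assumes r: "0 < r" "r < 1" and w0: "wstep f x (k - 1) \<noteq> 0"
  defines "w \<equiv> wstep f x k" and "w' \<equiv> wstep f x (k - 1)"
    and "\<alpha> \<equiv> na_lambda f r x k * na_gamma f x k"
  shows "\<bar>\<alpha>\<bar> * norm w' \<le> r * (\<bar>1 - \<alpha>\<bar> * norm w)"
    and "norm (w - \<alpha> *\<^sub>R (w - w')) \<le> norm w"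
proof -
  define \<gamma> where "\<gamma> = na_gamma f x k"
  define \<beta> where "\<beta> = na_beta f r x k"
  define l where "l = na_lambda f r x k"
  define d where "d = w - w'"
  have w': "norm w' > 0" using w0 by (simp add: w'_def)
  have \<gamma>d: "\<gamma> * (d \<bullet> d) = d \<bullet> w"
    by (simp add: \<gamma>_def na_gamma_def d_def w_def w'_def dot_square_norm)
  have \<eta>: "na_eta f x k = norm w / norm w'" by (simp add: na_eta_def w_def w'_def)
  have \<beta>0: "\<beta> \<ge> 0" using r by (simp add: \<beta>_def na_beta_def \<eta>)
  have \<beta>r: "\<beta> * norm w' \<le> r * norm w"
  proof -
    have "\<beta> * norm w' = min (norm w / norm w') r * norm w"
      using w' by (simp add: \<beta>_def na_beta_def \<eta>)
    also have "\<dots> \<le> r * norm w" by (intro mult_right_mono) auto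
    finally show ?thesis .
  qed
  \<comment> \<open>A negative \<open>\<gamma>\<close> means \<open>w \<bullet> w < w' \<bullet> w\<close>, which is possible only for a decreasing step length.\<close>
  have neg: "\<beta> < 1" if "\<gamma> < 0"
  proof -
    have "\<gamma> = (d \<bullet> w) / (norm d)\<^sup>2"
      by (simp add: \<gamma>_def na_gamma_def d_def w_def w'_def)
    then have "d \<bullet> w < 0" using that by (simp add: divide_less_0_iff)
    then have "norm w * norm w < w' \<bullet> w"
      by (simp add: d_def inner_diff_left dot_square_norm power2_eq_square)
    also have "\<dots> \<le> norm w' * norm w" by (rule norm_cauchy_schwarz)
    finally have "norm w < norm w'" by (simp add: mult_less_cancel_right)
    then have "norm w / norm w' < 1" using w' by simp
    moreover have "r * (norm w / norm w') \<le> 1 * (norm w / norm w')"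
      using r by (intro mult_right_mono) auto
    moreover have "\<beta> \<le> r * (norm w / norm w')" using \<beta>r w' by (simp add: field_simps)
    ultimately show ?thesis by linarith
  qed
  have l_eq: "l = (if \<gamma> = 0 \<or> \<gamma> \<ge> 1 then 0
               else if \<bar>\<gamma>\<bar> / \<bar>1 - \<gamma>\<bar> > \<beta> then \<beta> / (\<gamma> * (\<beta> + sgn \<gamma>)) else 1)"
    by (simp add: l_def na_lambda_def \<gamma>_def \<beta>_def Let_def)
  have b: "0 \<le> l" "l \<le> 1" "\<bar>l * \<gamma>\<bar> \<le> \<beta> * \<bar>1 - l * \<gamma>\<bar>"
    unfolding l_eq using relaxation_bounds[of \<beta> \<gamma>, OF \<beta>0 neg] by blast+
  have \<alpha>: "\<alpha> = l * \<gamma>" by (simp add: \<alpha>_def l_def \<gamma>_def)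
  have "\<bar>\<alpha>\<bar> * norm w' \<le> (\<beta> * \<bar>1 - \<alpha>\<bar>) * norm w'"
    using b(3) by (simp add: \<alpha> mult_right_mono)
  also have "\<dots> \<le> \<bar>1 - \<alpha>\<bar> * (r * norm w)"
    using mult_left_mono[OF \<beta>r, of "\<bar>1 - \<alpha>\<bar>"] by (simp add: algebra_simps)
  finally show "\<bar>\<alpha>\<bar> * norm w' \<le> r * (\<bar>1 - \<alpha>\<bar> * norm w)" by (simp add: algebra_simps)
  have "(norm (w - \<alpha> *\<^sub>R d))\<^sup>2 = w \<bullet> w - 2 * \<alpha> * (d \<bullet> w) + \<alpha>\<^sup>2 * (d \<bullet> d)"
    unfolding power2_norm_eq_inner
    by (simp add: inner_diff_left inner_diff_right inner_commute power2_eq_square algebra_simps)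
  also have "\<dots> = w \<bullet> w - (l * (2 - l)) * (\<gamma>\<^sup>2 * (d \<bullet> d))"
    unfolding \<gamma>d[symmetric] \<alpha> by (simp add: power2_eq_square algebra_simps)
  also have "\<dots> \<le> w \<bullet> w" using b(1,2) by simp
  finally have "(norm (w - \<alpha> *\<^sub>R d))\<^sup>2 \<le> (norm w)\<^sup>2" by (simp add: power2_norm_eq_inner)
  then show "norm (w - \<alpha> *\<^sub>R (w - w')) \<le> norm w"
    unfolding d_def by (rule power2_le_imp_le) simp
qed

section \<open>The Anderson step\<close>

text \<open>
  A step of this quality is essentially \<open>-(e \<bullet> q / 2) q\<close>, so that its length determines the null
  component of the error up to a factor close to 2, and the null component of \<open>e + w\<close> is almost the
  opposite of that of \<open>w\<close>.
\<close>

lemma newton_estimateD: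
  assumes q: "norm q = 1" and "0 \<le> \<epsilon>" "\<epsilon> \<le> 1 / 100" and est: "newton_estimate q C \<epsilon> e w"
  shows "e \<bullet> q \<noteq> 0" "norm e \<le> 2 * \<bar>e \<bullet> q\<bar>" "\<bar>(e + w) \<bullet> q + w \<bullet> q\<bar> \<le> \<epsilon> * \<bar>e \<bullet> q\<bar>"
    "norm (perp q w) \<le> \<epsilon> * \<bar>e \<bullet> q\<bar>" "norm (perp q (e + w)) \<le> C * (norm e)\<^sup>2"
    "49 * \<bar>e \<bullet> q\<bar> \<le> 100 * norm w" "norm w \<le> 52 / 100 * \<bar>e \<bullet> q\<bar>"
proof -
  show "e \<bullet> q \<noteq> 0" "norm e \<le> 2 * \<bar>e \<bullet> q\<bar>"
    and r: "norm (perp q w) \<le> \<epsilon> * \<bar>e \<bullet> q\<bar>" and "norm (perp q (e + w)) \<le> C * (norm e)\<^sup>2"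
    using est by (auto simp: newton_estimate_def)
  have z: "\<bar>2 * (w \<bullet> q) + e \<bullet> q\<bar> \<le> \<epsilon> * \<bar>e \<bullet> q\<bar>"
    using est by (simp add: newton_estimate_def)
  then show "\<bar>(e + w) \<bullet> q + w \<bullet> q\<bar> \<le> \<epsilon> * \<bar>e \<bullet> q\<bar>"
    by (simp add: inner_add_left algebra_simps)
  have \<epsilon>: "\<epsilon> * \<bar>e \<bullet> q\<bar> \<le> 1 / 100 * \<bar>e \<bullet> q\<bar>" using assms by (intro mult_right_mono) auto
  show "49 * \<bar>e \<bullet> q\<bar> \<le> 100 * norm w"
    using z \<epsilon> abs_inner_unit_le[OF q, of w] by linarith
  show "norm w \<le> 52 / 100 * \<bar>e \<bullet> q\<bar>"
    using z \<epsilon> r norm_le_components[OF q, of w] by linarith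
qed

text \<open>
  Both the error of replacing the null component of \<open>e''\<close> by that of \<open>-v\<close> and the part of \<open>v\<close>
  across \<open>q\<close> are at most \<open>8 \<epsilon> t\<close> with \<open>t = \<bar>1 - \<alpha>\<bar> \<parallel>w'\<parallel>\<close>, because the guard lets the
  older point contribute no more than the newer one. The guard also gives \<open>(1 - r) t \<le> \<parallel>v\<parallel>\<close>, so
  \<open>\<epsilon> = (1 - r)/100\<close> makes these errors small relative to \<open>v\<close> itself. The ideal contraction factor
  \<open>1/2\<close> deteriorates to at most \<open>(108/100)(52/100)\<close>, which leaves room below \<open>3/4\<close>.
\<close>

lemma anderson_step:
  fixes e e' w w' :: "'a::real_inner"
  assumes q: "norm q = 1" and r: "0 < r" "r < 1" and \<epsilon>: "\<epsilon> = (1 - r) / 100" and C: "C > 0"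
    and est: "newton_estimate q C \<epsilon> e w" "newton_estimate q C \<epsilon> e' w'"
    and guard: "\<bar>\<alpha>\<bar> * norm w \<le> r * (\<bar>1 - \<alpha>\<bar> * norm w')"
  defines "v \<equiv> w' - \<alpha> *\<^sub>R (w' - w)" and "e'' \<equiv> (1 - \<alpha>) *\<^sub>R (e' + w') + \<alpha> *\<^sub>R (e + w)"
  shows "norm (perp q e'') \<le> 2 * C * max (\<bar>1 - \<alpha>\<bar> * (norm e')\<^sup>2) (\<bar>\<alpha>\<bar> * (norm e)\<^sup>2)"
    and "\<bar>e'' \<bullet> q\<bar> \<le> 3 / 4 * (norm v / norm w') * \<bar>e' \<bullet> q\<bar>"
    and "e'' \<bullet> q \<noteq> 0"
    and "norm (perp q e'') \<le> 32 * C / (1 - r) * max (norm e') (norm e) * \<bar>e'' \<bullet> q\<bar>"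
proof -
  define a a' where "a = \<bar>e \<bullet> q\<bar>" and "a' = \<bar>e' \<bullet> q\<bar>"
  define b b' where "b = \<bar>\<alpha>\<bar>" and "b' = \<bar>1 - \<alpha>\<bar>"
  define t where "t = b' * norm w'"
  have \<epsilon>': "0 \<le> \<epsilon>" "\<epsilon> \<le> 1 / 100" using r \<epsilon> by auto
  note E = newton_estimateD[OF q \<epsilon>' est(1), folded a_def]
  note E' = newton_estimateD[OF q \<epsilon>' est(2), folded a'_def]
  have pos: "a > 0" "a' > 0" "b \<ge> 0" "b' \<ge> 0" using E(1) E'(1) by (auto simp: a_def a'_def b_def b'_def)
  have w': "norm w' > 0" using E'(6) pos by linarith
  have guard': "b * norm w \<le> r * t" using guard by (simp add: b_def b'_def t_def)
  have t: "t > 0"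
  proof -
    have "w \<noteq> 0" using E(6) pos by auto
    then have "\<alpha> \<noteq> 1" using guard by auto
    then show ?thesis using w' by (simp add: t_def b'_def)
  qed
  have bt: "b * norm w \<le> t"
  proof -
    have "r * t \<le> 1 * t" using r t by (intro mult_right_mono) auto
    then show ?thesis using guard' by linarith
  qed
  have a_w: "a \<le> 4 * norm w" "a' \<le> 4 * norm w'"
    using E(6) E'(6) norm_ge_zero[of w] norm_ge_zero[of w'] by linarith+
  have ba: "b * a \<le> 4 * t"
    using mult_left_mono[OF a_w(1) pos(3)] bt by simp
  have ba': "b' * a' \<le> 4 * t"
    using mult_left_mono[OF a_w(2) pos(4)] by (simp add: t_def)
  have small: "b' * (\<epsilon> * a') + b * (\<epsilon> * a) \<le> 8 * \<epsilon> * t"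
    using mult_left_mono[OF add_mono[OF ba' ba], of \<epsilon>] \<epsilon>' by (simp add: algebra_simps)
  have v: "v = (1 - \<alpha>) *\<^sub>R w' + \<alpha> *\<^sub>R w" by (simp add: v_def algebra_simps)
  \<comment> \<open>At each of the two points \<open>e + w\<close> is almost \<open>-w\<close> along \<open>q\<close>, hence so is the combination.\<close>
  have refl: "\<bar>e'' \<bullet> q + v \<bullet> q\<bar> \<le> 8 * \<epsilon> * t"
  proof -
    have "e'' \<bullet> q + v \<bullet> q = (1 - \<alpha>) * ((e' + w') \<bullet> q + w' \<bullet> q) + \<alpha> * ((e + w) \<bullet> q + w \<bullet> q)"
      by (simp add: e''_def v inner_add_left inner_diff_left algebra_simps)
    then have "\<bar>e'' \<bullet> q + v \<bullet> q\<bar> \<le> b' * \<bar>(e' + w') \<bullet> q + w' \<bullet> q\<bar> + b * \<bar>(e + w) \<bullet> q + w \<bullet> q\<bar>"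
      unfolding b_def b'_def abs_mult[symmetric] by linarith
    also have "\<dots> \<le> b' * (\<epsilon> * a') + b * (\<epsilon> * a)"
      using E(3) E'(3) pos by (intro add_mono mult_left_mono) auto
    finally show ?thesis using small by linarith
  qed
  \<comment> \<open>The steps are almost parallel to \<open>q\<close>, so the length of \<open>v\<close> is carried by \<open>v \<bullet> q\<close>.\<close>
  have rv: "norm (perp q v) \<le> 8 * \<epsilon> * t"
  proof -
    have "norm (perp q v) \<le> b' * norm (perp q w') + b * norm (perp q w)"
      unfolding v perp_add perp_scaleR b_def b'_def norm_scaleR[symmetric] by (rule norm_triangle_ineq)
    also have "\<dots> \<le> b' * (\<epsilon> * a') + b * (\<epsilon> * a)"
      using E(4) E'(4) pos by (intro add_mono mult_left_mono) auto
    finally show ?thesis using small by linarith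
  qed
  have v_low: "(1 - r) * t \<le> norm v"
  proof -
    have "t = norm ((1 - \<alpha>) *\<^sub>R w')" by (simp add: t_def b'_def)
    also have "\<dots> = norm (v - \<alpha> *\<^sub>R w)" by (simp add: v)
    also have "\<dots> \<le> norm v + b * norm w"
      using norm_triangle_ineq4[of v "\<alpha> *\<^sub>R w"] by (simp add: b_def)
    finally show ?thesis using guard' by (simp add: algebra_simps)
  qed
  have \<epsilon>t: "\<epsilon> * t = (1 - r) * t / 100" by (simp add: \<epsilon>)
  have rt: "(1 - r) * t > 0" using r t by simp
  have low: "(1 - r) * t / 2 \<le> \<bar>e'' \<bullet> q\<bar>"
    using refl rv v_low norm_le_components[OF q, of v] \<epsilon>t rt by linarith
  then show "e'' \<bullet> q \<noteq> 0" using rt by auto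
  have "\<bar>e'' \<bullet> q\<bar> \<le> 108 / 100 * norm v"
    using refl v_low abs_inner_unit_le[OF q, of v] \<epsilon>t by linarith
  then have "\<bar>e'' \<bullet> q\<bar> * norm w' \<le> (108 / 100 * norm v) * (52 / 100 * a')"
    using E'(7) by (intro mult_mono) auto
  also have "\<dots> \<le> 3 / 4 * (norm v * a')"
  proof -
    have "norm v * a' \<ge> 0" using pos by simp
    moreover have "(108 / 100 * norm v) * (52 / 100 * a') = 5616 / 10000 * (norm v * a')" by simp
    ultimately show ?thesis by linarith
  qed
  finally show "\<bar>e'' \<bullet> q\<bar> \<le> 3 / 4 * (norm v / norm w') * \<bar>e' \<bullet> q\<bar>"
    using w' by (simp add: a'_def field_simps)
  let ?m = "max (b' * (norm e')\<^sup>2) (b * (norm e)\<^sup>2)"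
  have "norm (perp q e'') \<le> b' * norm (perp q (e' + w')) + b * norm (perp q (e + w))"
    unfolding e''_def perp_add[of q "_ *\<^sub>R _"] perp_scaleR b_def b'_def norm_scaleR[symmetric]
    by (rule norm_triangle_ineq)
  also have "\<dots> \<le> b' * (C * (norm e')\<^sup>2) + b * (C * (norm e)\<^sup>2)"
    using E(5) E'(5) pos by (intro add_mono mult_left_mono) auto
  also have "\<dots> \<le> C * ?m + C * ?m"
  proof (rule add_mono)
    show "b' * (C * (norm e')\<^sup>2) \<le> C * ?m" "b * (C * (norm e)\<^sup>2) \<le> C * ?m"
      using C by (simp_all add: mult.left_commute)
  qed
  finally have R: "norm (perp q e'') \<le> 2 * C * ?m" by simp
  then show "norm (perp q e'') \<le> 2 * C * max (\<bar>1 - \<alpha>\<bar> * (norm e')\<^sup>2) (\<bar>\<alpha>\<bar> * (norm e)\<^sup>2)"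
    by (simp add: b_def b'_def)
  let ?n = "max (norm e') (norm e)"
  have aux: "c * (norm z)\<^sup>2 \<le> 8 * t * ?n" if "c * s \<le> 4 * t" "c \<ge> 0" "norm z \<le> 2 * s" "norm z \<le> ?n"
    for c s and z :: 'a
  proof -
    have "c * norm z \<le> c * (2 * s)" using that by (intro mult_left_mono) auto
    then have "c * norm z \<le> 8 * t" using that(1) by simp
    then have "(c * norm z) * norm z \<le> (8 * t) * ?n"
      by (rule mult_mono[OF _ that(4)]) (use t in auto)
    then show ?thesis by (simp add: power2_eq_square mult.assoc)
  qed
  have "?m \<le> 8 * t * ?n"
    using aux[OF ba' pos(4) E'(2)] aux[OF ba pos(3) E(2)] by simp
  then have "2 * C * ?m \<le> 2 * C * (8 * t * ?n)" using C by (intro mult_left_mono) auto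
  also have "\<dots> = 32 * C / (1 - r) * ?n * ((1 - r) * t / 2)" using r by (simp add: field_simps)
  also have "\<dots> \<le> 32 * C / (1 - r) * ?n * \<bar>e'' \<bullet> q\<bar>"
    using low C r by (intro mult_left_mono) (auto intro!: mult_nonneg_nonneg simp: le_max_iff_disj)
  finally show "norm (perp q e'') \<le> 32 * C / (1 - r) * max (norm e') (norm e) * \<bar>e'' \<bullet> q\<bar>"
    using R by linarith
qed

section \<open>Convergence of the iteration\<close>

text \<open>
  The Newton estimate at a point needs that point to be in the cone, and each step puts the next
  point there: its slope is at most \<open>M \<parallel>e 0\<parallel>\<close>, with \<open>M = 32 C / (1 - r)\<close> from \<open>anderson_step\<close>, and
  this is at most \<open>\<sigma>\<close>. A slope of at most \<open>1/4\<close> and the factor \<open>3/4\<close> for the null component keep the full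
  error from growing, as \<open>(5/4)(3/4) < 1\<close>.
\<close>

lemma anderson_invariant:
  fixes e w :: "nat \<Rightarrow> 'a::real_inner" and \<alpha> :: "nat \<Rightarrow> real"
  assumes q: "norm q = 1" and r: "0 < r" "r < 1" and C: "C > 0"
    and newton: "\<And>k. e k \<bullet> q \<noteq> 0 \<Longrightarrow> norm (perp q (e k)) \<le> \<sigma> * \<bar>e k \<bullet> q\<bar> \<Longrightarrow>
        norm (e k) \<le> norm (e 0) \<Longrightarrow> newton_estimate q C ((1 - r) / 100) (e k) (w k)"
    and guard: "\<And>k. w k \<noteq> 0 \<Longrightarrow> \<bar>\<alpha> k\<bar> * norm (w k) \<le> r * (\<bar>1 - \<alpha> k\<bar> * norm (w (Suc k)))"
      "\<And>k. w k \<noteq> 0 \<Longrightarrow> norm (w (Suc k) - \<alpha> k *\<^sub>R (w (Suc k) - w k)) \<le> norm (w (Suc k))"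
    and first: "e (Suc 0) = e 0 + w 0"
    and step: "\<And>k. e (Suc (Suc k)) = (1 - \<alpha> k) *\<^sub>R (e (Suc k) + w (Suc k)) + \<alpha> k *\<^sub>R (e k + w k)"
    and start: "e 0 \<bullet> q \<noteq> 0" "norm (perp q (e 0)) \<le> \<sigma> * \<bar>e 0 \<bullet> q\<bar>"
    and \<sigma>: "\<sigma> \<le> 1 / 4" "32 * C / (1 - r) * norm (e 0) \<le> \<sigma>"
  shows "newton_estimate q C ((1 - r) / 100) (e k) (w k)"
    and "norm (e (Suc k)) \<le> norm (e 0)"
    and "\<bar>e (Suc k) \<bullet> q\<bar> \<le> 3 / 4 * \<bar>e k \<bullet> q\<bar>"
    and "norm (perp q (e (Suc k))) \<le> 32 * C / (1 - r) * norm (e 0) * \<bar>e (Suc k) \<bullet> q\<bar>"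
proof -
  define M where "M = 32 * C / (1 - r)"
  define \<epsilon> where "\<epsilon> = (1 - r) / 100"
  have M: "32 * C \<le> M" using r C by (simp add: M_def field_simps)
  have \<epsilon>: "0 \<le> \<epsilon>" "\<epsilon> \<le> 1 / 100" using r by (auto simp: \<epsilon>_def)
  define P where "P k \<longleftrightarrow> e k \<bullet> q \<noteq> 0 \<and> norm (e k) \<le> norm (e 0) \<and> norm (perp q (e k)) \<le> \<sigma> * \<bar>e k \<bullet> q\<bar>" for k
  define S where "S k \<longleftrightarrow> \<bar>e (Suc k) \<bullet> q\<bar> \<le> 3 / 4 * \<bar>e k \<bullet> q\<bar> \<and>
      norm (perp q (e (Suc k))) \<le> M * norm (e 0) * \<bar>e (Suc k) \<bullet> q\<bar>" for k
  have est: "newton_estimate q C \<epsilon> (e k) (w k)" if "P k" for k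
    using newton[of k] that by (simp add: P_def \<epsilon>_def)
  have next_P: "P (Suc k)" if "P k" "S k" "e (Suc k) \<bullet> q \<noteq> 0" for k
  proof -
    have "norm (perp q (e (Suc k))) \<le> \<sigma> * \<bar>e (Suc k) \<bullet> q\<bar>"
      using that(2) \<sigma>(2) mult_right_mono[of "M * norm (e 0)" \<sigma> "\<bar>e (Suc k) \<bullet> q\<bar>"]
      by (simp add: S_def M_def)
    moreover have "\<sigma> * \<bar>e (Suc k) \<bullet> q\<bar> \<le> 1 / 4 * \<bar>e (Suc k) \<bullet> q\<bar>"
      using \<sigma>(1) by (intro mult_right_mono) auto
    ultimately have "norm (e (Suc k)) \<le> 5 / 4 * \<bar>e (Suc k) \<bullet> q\<bar>"
      and *: "norm (perp q (e (Suc k))) \<le> \<sigma> * \<bar>e (Suc k) \<bullet> q\<bar>"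
      using norm_le_components[OF q, of "e (Suc k)"] by linarith+
    then have "norm (e (Suc k)) \<le> \<bar>e k \<bullet> q\<bar>"
      using that(2) unfolding S_def by linarith
    also have "\<dots> \<le> norm (e 0)"
      using abs_inner_unit_le[OF q, of "e k"] that(1) by (simp add: P_def)
    finally show ?thesis using * that(3) by (simp add: P_def)
  qed
  have P0: "P 0" using start by (simp add: P_def)
  \<comment> \<open>The first step is a plain Newton step, so it has to be treated on its own.\<close>
  have S0: "S 0 \<and> e (Suc 0) \<bullet> q \<noteq> 0"
  proof -
    note E = newton_estimateD[OF q \<epsilon> est[OF P0]]
    have "\<epsilon> * \<bar>e 0 \<bullet> q\<bar> \<le> 1 / 100 * \<bar>e 0 \<bullet> q\<bar>" using \<epsilon> by (intro mult_right_mono) auto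
    moreover have "e (Suc 0) \<bullet> q = e 0 \<bullet> q + w 0 \<bullet> q" by (simp add: first inner_add_left)
    ultimately have "\<bar>2 * (e (Suc 0) \<bullet> q) - e 0 \<bullet> q\<bar> \<le> 1 / 100 * \<bar>e 0 \<bullet> q\<bar>"
      using E(3) unfolding inner_add_left by linarith
    then have "\<bar>e (Suc 0) \<bullet> q\<bar> \<le> 3 / 4 * \<bar>e 0 \<bullet> q\<bar>" and low: "\<bar>e 0 \<bullet> q\<bar> \<le> 4 * \<bar>e (Suc 0) \<bullet> q\<bar>"
      by linarith+
    moreover have "norm (perp q (e (Suc 0))) \<le> M * norm (e 0) * \<bar>e (Suc 0) \<bullet> q\<bar>"
    proof -
      have "norm (perp q (e (Suc 0))) \<le> C * norm (e 0) * norm (e 0)"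
        using E(5) by (simp add: first power2_eq_square mult.assoc)
      also have "\<dots> \<le> C * norm (e 0) * (8 * \<bar>e (Suc 0) \<bullet> q\<bar>)"
        using E(2) low C by (intro mult_left_mono) auto
      also have "\<dots> = 8 * C * (norm (e 0) * \<bar>e (Suc 0) \<bullet> q\<bar>)" by simp
      also have "\<dots> \<le> M * (norm (e 0) * \<bar>e (Suc 0) \<bullet> q\<bar>)"
        using M C by (intro mult_right_mono) auto
      finally show ?thesis by (simp add: mult.assoc)
    qed
    moreover have "e (Suc 0) \<bullet> q \<noteq> 0" using low E(1) by auto
    ultimately show ?thesis by (simp add: S_def)
  qed
  have next_S: "S (Suc k) \<and> e (Suc (Suc k)) \<bullet> q \<noteq> 0" if P: "P k" "P (Suc k)" for k
  proof -
    have E: "newton_estimate q C \<epsilon> (e k) (w k)" "newton_estimate q C \<epsilon> (e (Suc k)) (w (Suc k))"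
      using P est by auto
    have w: "w k \<noteq> 0" "w (Suc k) \<noteq> 0"
      using newton_estimateD(1,6)[OF q \<epsilon> E(1)] newton_estimateD(1,6)[OF q \<epsilon> E(2)] by auto
    note A = anderson_step[OF q r \<epsilon>_def C E guard(1)[OF w(1)], folded step M_def]
    let ?\<theta> = "norm (w (Suc k) - \<alpha> k *\<^sub>R (w (Suc k) - w k)) / norm (w (Suc k))"
    have "?\<theta> \<le> 1" using guard(2)[OF w(1)] w by simp
    then have "3 / 4 * ?\<theta> * \<bar>e (Suc k) \<bullet> q\<bar> \<le> 3 / 4 * 1 * \<bar>e (Suc k) \<bullet> q\<bar>"
      by (intro mult_right_mono mult_left_mono) auto
    then have "\<bar>e (Suc (Suc k)) \<bullet> q\<bar> \<le> 3 / 4 * \<bar>e (Suc k) \<bullet> q\<bar>" using A(2) by linarith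
    moreover have "M * max (norm (e (Suc k))) (norm (e k)) * \<bar>e (Suc (Suc k)) \<bullet> q\<bar>
        \<le> M * norm (e 0) * \<bar>e (Suc (Suc k)) \<bullet> q\<bar>"
      using P M C by (intro mult_right_mono mult_left_mono) (auto simp: P_def)
    ultimately show ?thesis using A(3,4) by (simp add: S_def)
  qed
  have "P k \<and> S k \<and> e (Suc k) \<bullet> q \<noteq> 0" for k
  proof (induction k)
    case 0
    then show ?case using P0 S0 by simp
  next
    case (Suc k)
    then show ?case using next_P next_S by blast
  qed
  then have inv: "P k" "S k" "P (Suc k)" for k by auto
  show "newton_estimate q C ((1 - r) / 100) (e k) (w k)" using est[OF inv(1)] by (simp add: \<epsilon>_def)
  show "norm (e (Suc k)) \<le> norm (e 0)" using inv(3) by (simp add: P_def)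
  show "\<bar>e (Suc k) \<bullet> q\<bar> \<le> 3 / 4 * \<bar>e k \<bullet> q\<bar>"
    and "norm (perp q (e (Suc k))) \<le> 32 * C / (1 - r) * norm (e 0) * \<bar>e (Suc k) \<bullet> q\<bar>"
    using inv(2) by (auto simp: S_def M_def)
qed

section \<open>The safeguarded Newton-Anderson iteration\<close>

theorem theorem3p1:
  fixes f :: "real ^ 'n \<Rightarrow> real ^ 'n" and xstar \<phi> :: "real ^ 'n" and rhat :: real
  assumes "C3 f"
    and "f xstar = 0"
    and "\<forall>u\<in>rangesp (fderiv f xstar). \<forall>v\<in>nullsp (fderiv f xstar). orthogonal u v"
    and "dim (nullsp (fderiv f xstar)) = 1"
    and "\<phi> \<noteq> 0" and "span {\<phi>} = nullsp (fderiv f xstar)"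
    and "bij_betw (Dhat f xstar \<phi>) (nullsp (fderiv f xstar)) (nullsp (fderiv f xstar))"
    and "0 < rhat" and "rhat < 1"
  shows "\<exists>\<sigma>hat>0. \<exists>\<rho>hat>0. \<exists>C>0. \<exists>\<kappa>. 1 / 2 < \<kappa> \<and> \<kappa> < 1 \<and>
    (\<forall>x. newton_anderson f rhat x \<and> projN f xstar (x 0 - xstar) \<noteq> 0 \<and>
         sig f xstar x 0 < \<sigma>hat \<and> norm (x 0 - xstar) < \<rho>hat \<longrightarrow>
       iter_ok f xstar x \<and>
       (\<forall>k. W f xstar x (k + 1) \<subseteq> region f xstar \<rho>hat \<sigma>hat) \<and>
       x \<longlonglongrightarrow> xstar \<and>
       (\<forall>k\<ge>1.
          norm (projR f xstar (x (k + 1) - xstar))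
            \<le> C * max (\<bar>1 - na_lambda f rhat x (k + 1) * na_gamma f x (k + 1)\<bar> * (norm (x k - xstar))\<^sup>2)
                      (\<bar>na_lambda f rhat x (k + 1) * na_gamma f x (k + 1)\<bar> * (norm (x (k - 1) - xstar))\<^sup>2) \<and>
          norm (projN f xstar (x (k + 1) - xstar))
            \<le> \<kappa> * na_theta f rhat x (k + 1) * norm (projN f xstar (x k - xstar)))) \<and>
    (\<forall>\<sigma>. 0 < \<sigma> \<and> \<sigma> < \<sigma>hat \<longrightarrow>
       (\<exists>\<rho>. 0 < \<rho> \<and> \<rho> \<le> \<rho>hat \<and>
         (\<forall>x. newton_anderson f rhat x \<and> projN f xstar (x 0 - xstar) \<noteq> 0 \<and>
              \<sigma> \<le> sig f xstar x 0 \<and> sig f xstar x 0 < \<sigma>hat \<and> norm (x 0 - xstar) < \<rho> \<longrightarrow>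
            (\<forall>k. W f xstar x (k + 1) \<subseteq> W f xstar x 0))))"
proof -
  let ?A = "fderiv f xstar" and ?B = "fderiv (fderiv f) xstar"
  have diff: "f differentiable at y" "fderiv f differentiable at y" for y
    using assms(1) by (auto simp: C3_def)
  define q where "q = (1 / norm \<phi>) *\<^sub>R \<phi>"
  have q: "norm q = 1" and \<phi>: "\<phi> = norm \<phi> *\<^sub>R q" using assms(5) by (simp_all add: q_def)
  have ker: "nullsp ?A = span {q}"
  proof -
    have "q \<in> span {\<phi>}" unfolding q_def by (intro span_scale span_base) simp
    moreover have "\<phi> \<in> span {q}" by (subst \<phi>) (intro span_scale span_base, simp)
    ultimately have "span {q} = span {\<phi>}" by (simp add: span_eq)
    then show ?thesis using assms(6) by simp
  qed
  have Aq: "?A q = 0"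
  proof -
    have "q \<in> nullsp ?A" by (simp add: ker span_base)
    then show ?thesis by (simp add: nullsp_def)
  qed
  note range = orth_range_of_line_kernel[OF assms(3) ker q]
  have ortho: "?A u \<bullet> q = 0" for u
  proof -
    have "?A u \<in> rangesp ?A" by (simp add: rangesp_def)
    then show ?thesis by (simp add: range(1) inner_commute)
  qed
  have projN: "projN f xstar v = (v \<bullet> q) *\<^sub>R q" for v
  proof (rule orth_proj_eqI)
    show "orthogonal (v - (v \<bullet> q) *\<^sub>R q) z" if "z \<in> nullsp ?A" for z
      using that q by (auto simp: ker span_singleton orthogonal_def inner_diff_left dot_square_norm)
  qed (simp_all add: ker span_scale span_base)
  have projR: "projR f xstar v = perp q v" for v
  proof (rule orth_proj_eqI)
    show "subspace (rangesp ?A)" unfolding range(1) by (rule subspace_hyperplane)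
    show "perp q v \<in> rangesp ?A"
      using q by (simp add: range(1) perp_def inner_diff_right inner_commute dot_square_norm)
    show "orthogonal (v - perp q v) z" if "z \<in> rangesp ?A" for z
      using that by (simp add: range(1) perp_def orthogonal_def)
  qed
  have normN: "norm (projN f xstar v) = \<bar>v \<bullet> q\<bar>" for v using q by (simp add: projN)
  have N0: "projN f xstar v \<noteq> 0 \<longleftrightarrow> v \<bullet> q \<noteq> 0" for v
    using q by (auto simp: projN)
  have nondeg: "?B q q \<bullet> q \<noteq> 0"
  proof
    assume "?B q q \<bullet> q = 0"
    moreover have "?B \<phi> = norm \<phi> *\<^sub>R ?B q" by (subst \<phi>) (rule blinfun.scaleR_right)
    ultimately have "Dhat f xstar \<phi> q = 0"
      using q by (simp add: Dhat_def projN dot_square_norm blinfun.scaleR_left)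
    moreover have "Dhat f xstar \<phi> 0 = 0" by (simp add: Dhat_def projN)
    moreover have "q \<in> nullsp ?A" "0 \<in> nullsp ?A" by (simp_all add: ker span_base span_zero)
    ultimately have "q = 0"
      using assms(7) unfolding bij_betw_def inj_on_def by metis
    with q show False by simp
  qed
  obtain c where c: "c > 0" "\<And>u. c * norm (perp q u) \<le> norm (?A u)" using range(2) by blast
  define \<epsilon> where "\<epsilon> = (1 - rhat) / 100"
  have \<epsilon>: "0 < \<epsilon>" "0 \<le> \<epsilon>" "\<epsilon> \<le> 1 / 100" using assms(8,9) by (auto simp: \<epsilon>_def)
  obtain C where C: "C > 0" and "\<forall>\<epsilon>>0. \<exists>\<tau>>0. \<forall>x. (x - xstar) \<bullet> q \<noteq> 0 \<longrightarrow>
      norm (perp q (x - xstar)) \<le> \<tau> * \<bar>(x - xstar) \<bullet> q\<bar> \<longrightarrow> norm (x - xstar) < \<tau> \<longrightarrow>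
      bij (blinfun_apply (fderiv f x)) \<and>
      newton_estimate q C \<epsilon> (x - xstar) (- inv (blinfun_apply (fderiv f x)) (f x))"
    using newton_step_near_singular_root[OF diff(1) diff(2) assms(2) q Aq ortho c nondeg] by blast
  with \<epsilon>(1) obtain \<tau> where \<tau>: "\<tau> > 0" and newton: "\<And>x. (x - xstar) \<bullet> q \<noteq> 0 \<Longrightarrow>
      norm (perp q (x - xstar)) \<le> \<tau> * \<bar>(x - xstar) \<bullet> q\<bar> \<Longrightarrow> norm (x - xstar) < \<tau> \<Longrightarrow>
      bij (blinfun_apply (fderiv f x)) \<and>
      newton_estimate q C \<epsilon> (x - xstar) (- inv (blinfun_apply (fderiv f x)) (f x))"
    by meson
  \<comment> \<open>The cone must be narrow enough for the Newton estimate and have slope at most \<open>1/4\<close>; after that the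
     radius is chosen so that \<open>M \<parallel>e\<^sub>0\<parallel>\<close>, the bound for all later slopes, is below \<open>\<sigma>hat\<close>.\<close>
  define M where "M = 32 * C / (1 - rhat)"
  define \<sigma>hat where "\<sigma>hat = min \<tau> (1 / 4)"
  define \<rho>hat where "\<rho>hat = min \<tau> (\<sigma>hat / M)"
  have M: "M > 0" using C assms(9) by (simp add: M_def)
  have \<sigma>hat: "\<sigma>hat > 0" "\<sigma>hat \<le> \<tau>" "\<sigma>hat \<le> 1 / 4" using \<tau> by (auto simp: \<sigma>hat_def)
  have \<rho>hat: "\<rho>hat > 0" "\<rho>hat \<le> \<tau>" "\<rho>hat \<le> \<sigma>hat / M" using \<tau> \<sigma>hat M by (auto simp: \<rho>hat_def)
  have main: "iter_ok f xstar x"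
      "\<And>\<rho> \<sigma>. norm (x 0 - xstar) \<le> \<rho> \<Longrightarrow> M * norm (x 0 - xstar) \<le> \<sigma> \<Longrightarrow>
         W f xstar x (k + 1) \<subseteq> region f xstar \<rho> \<sigma>"
      "x \<longlonglongrightarrow> xstar"
      "k \<ge> 1 \<Longrightarrow> norm (projR f xstar (x (k + 1) - xstar))
         \<le> 2 * C * max (\<bar>1 - na_lambda f rhat x (k + 1) * na_gamma f x (k + 1)\<bar> * (norm (x k - xstar))\<^sup>2)
                 (\<bar>na_lambda f rhat x (k + 1) * na_gamma f x (k + 1)\<bar> * (norm (x (k - 1) - xstar))\<^sup>2)"
      "k \<ge> 1 \<Longrightarrow> norm (projN f xstar (x (k + 1) - xstar))
         \<le> 3 / 4 * na_theta f rhat x (k + 1) * norm (projN f xstar (x k - xstar))"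
    if na: "newton_anderson f rhat x" and x0: "projN f xstar (x 0 - xstar) \<noteq> 0"
      "sig f xstar x 0 < \<sigma>hat" "norm (x 0 - xstar) < \<rho>hat" for x k
  proof -
    define e where "e k = x k - xstar" for k
    define w where "w k = wstep f x (Suc k)" for k
    define \<alpha> where "\<alpha> k = na_lambda f rhat x (Suc (Suc k)) * na_gamma f x (Suc (Suc k))" for k
    have start: "e 0 \<bullet> q \<noteq> 0" "norm (perp q (e 0)) \<le> \<sigma>hat * \<bar>e 0 \<bullet> q\<bar>"
      using x0 by (simp_all add: sig_def e_def N0 normN projR pos_divide_less_eq)
    have e0: "norm (e 0) < \<tau>" "M * norm (e 0) \<le> \<sigma>hat"
    proof -
      show "norm (e 0) < \<tau>" using x0(3) \<rho>hat(2) by (simp add: e_def)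
      have "norm (e 0) \<le> \<sigma>hat / M" using x0(3) \<rho>hat(3) by (simp add: e_def)
      then show "M * norm (e 0) \<le> \<sigma>hat" using M by (simp add: field_simps)
    qed
    have newton': "bij (blinfun_apply (fderiv f (x k))) \<and> newton_estimate q C \<epsilon> (e k) (w k)"
      if "e k \<bullet> q \<noteq> 0" "norm (perp q (e k)) \<le> \<sigma>hat * \<bar>e k \<bullet> q\<bar>" "norm (e k) \<le> norm (e 0)" for k
    proof -
      have "norm (perp q (e k)) \<le> \<tau> * \<bar>e k \<bullet> q\<bar>"
        using that(2) mult_right_mono[OF \<sigma>hat(2), of "\<bar>e k \<bullet> q\<bar>"] by simp
      then show ?thesis using newton[of "x k"] that(1,3) e0(1) by (simp add: e_def w_def wstep_def)
    qed
    have guard: "\<bar>\<alpha> k\<bar> * norm (w k) \<le> rhat * (\<bar>1 - \<alpha> k\<bar> * norm (w (Suc k)))"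
        "norm (w (Suc k) - \<alpha> k *\<^sub>R (w (Suc k) - w k)) \<le> norm (w (Suc k))" if "w k \<noteq> 0" for k
      using safeguard[OF assms(8,9), of f x "Suc (Suc k)"] that by (simp_all add: w_def \<alpha>_def)
    have first: "e (Suc 0) = e 0 + w 0"
      using na by (simp add: newton_anderson_def e_def w_def)
    have step: "e (Suc (Suc k)) = (1 - \<alpha> k) *\<^sub>R (e (Suc k) + w (Suc k)) + \<alpha> k *\<^sub>R (e k + w k)" for k
    proof -
      have "x (Suc (Suc k)) = x (Suc k) + w (Suc k) - \<alpha> k *\<^sub>R (x (Suc k) - x k + w (Suc k) - w k)"
        using na[unfolded newton_anderson_def, THEN conjunct2, rule_format, of "Suc k"]
        by (simp add: w_def \<alpha>_def)
      then show ?thesis by (simp add: e_def algebra_simps)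
    qed
    note inv = anderson_invariant[where e = e and w = w and \<alpha> = \<alpha>, OF q assms(8,9) C
        newton'[unfolded \<epsilon>_def, THEN conjunct2] guard first step start \<sigma>hat(3) e0(2)[unfolded M_def],
        folded \<epsilon>_def M_def]
    note est = newton_estimateD[OF q \<epsilon>(2,3) inv(1)]
    have cone: "norm (perp q (e k)) \<le> \<sigma>hat * \<bar>e k \<bullet> q\<bar> \<and> norm (e k) \<le> norm (e 0)" for k
    proof (cases k)
      case 0
      then show ?thesis using start by simp
    next
      case (Suc j)
      then show ?thesis
        using inv(2,4)[of j] mult_right_mono[OF e0(2), of "\<bar>e k \<bullet> q\<bar>"] by simp
    qed
    \<comment> \<open>Consecutive steps differ because their lengths decrease strictly: each is about half the null
       component of the error, which shrinks by \<open>3/4\<close>.\<close>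
    have w_ne: "w k \<noteq> 0" "w (Suc k) \<noteq> w k" for k
    proof -
      have "norm (w (Suc k)) < norm (w k)" "0 < norm (w k)"
        using est(1,6)[of k] est(7)[of "Suc k"] inv(3)[of k] by linarith+
      then show "w k \<noteq> 0" "w (Suc k) \<noteq> w k" by auto
    qed
    show "iter_ok f xstar x"
      unfolding iter_ok_def N0
    proof (intro conjI allI impI)
      show "bij (blinfun_apply (fderiv f (x k)))" "(x k - xstar) \<bullet> q \<noteq> 0" for k
        using newton'[OF est(1)] cone[of k] est(1)[of k] by (auto simp: e_def)
      show "wstep f x k \<noteq> 0" "wstep f x (k + 1) \<noteq> wstep f x k" if "1 \<le> k" for k
        using w_ne[of "k - 1"] that by (simp_all add: w_def)
    qed
    show "W f xstar x (k + 1) \<subseteq> region f xstar \<rho> \<sigma>"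
      if "norm (x 0 - xstar) \<le> \<rho>" "M * norm (x 0 - xstar) \<le> \<sigma>" for \<rho> \<sigma>
    proof
      fix y assume y: "y \<in> W f xstar x (k + 1)"
      have pos: "\<bar>e (k + 1) \<bullet> q\<bar> > 0" using est(1)[of "k + 1"] by simp
      have "norm (perp q (e (k + 1))) \<le> M * norm (e 0) * \<bar>e (k + 1) \<bullet> q\<bar>"
        using inv(4)[of k] by simp
      then have "sig f xstar x (k + 1) \<le> M * norm (e 0)"
        using pos by (simp add: sig_def projR normN e_def[symmetric] pos_divide_le_eq)
      then have "sig f xstar x (k + 1) \<le> \<sigma>" using that by (simp add: e_def)
      then have "sig f xstar x (k + 1) * norm (projN f xstar (y - xstar)) \<le> \<sigma> * norm (projN f xstar (y - xstar))"
        by (rule mult_right_mono) simp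
      moreover have "norm (x (k + 1) - xstar) \<le> \<rho>"
        using inv(2)[of k] that by (simp add: e_def)
      ultimately show "y \<in> region f xstar \<rho> \<sigma>"
        using y by (auto simp: W_def region_def)
    qed
    have geom: "\<bar>e k \<bullet> q\<bar> \<le> \<bar>e 0 \<bullet> q\<bar> * (3 / 4) ^ k" for k
    proof (induction k)
      case (Suc k)
      then show ?case using inv(3)[of k] by simp
    qed simp
    have "(\<lambda>k. 2 * \<bar>e 0 \<bullet> q\<bar> * (3 / 4) ^ k) \<longlonglongrightarrow> 2 * \<bar>e 0 \<bullet> q\<bar> * 0"
      by (intro tendsto_mult tendsto_const LIMSEQ_power_zero) simp
    moreover have "norm (e k) \<le> 2 * \<bar>e 0 \<bullet> q\<bar> * (3 / 4) ^ k" for k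
      using est(2)[of k] geom[of k] by simp
    ultimately have "e \<longlonglongrightarrow> 0"
      by (intro Lim_null_comparison[of e "\<lambda>k. 2 * \<bar>e 0 \<bullet> q\<bar> * (3 / 4) ^ k"]) auto
    then show "x \<longlonglongrightarrow> xstar" unfolding e_def by (rule LIM_zero_cancel)
    assume "1 \<le> k"
    then obtain j where j: "k = Suc j" by (cases k) auto
    note A = anderson_step[OF q assms(8,9) \<epsilon>_def C inv(1)[of j] inv(1)[of "Suc j"] guard(1)[OF w_ne(1)],
        folded step]
    show "norm (projR f xstar (x (k + 1) - xstar))
         \<le> 2 * C * max (\<bar>1 - na_lambda f rhat x (k + 1) * na_gamma f x (k + 1)\<bar> * (norm (x k - xstar))\<^sup>2)
                 (\<bar>na_lambda f rhat x (k + 1) * na_gamma f x (k + 1)\<bar> * (norm (x (k - 1) - xstar))\<^sup>2)"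
      using A(1) by (simp add: j projR e_def \<alpha>_def)
    show "norm (projN f xstar (x (k + 1) - xstar))
         \<le> 3 / 4 * na_theta f rhat x (k + 1) * norm (projN f xstar (x k - xstar))"
      using A(2) by (simp add: j normN e_def \<alpha>_def w_def na_theta_def)
  qed
  have bound: "M * norm (x 0 - xstar) \<le> s" if "norm (x 0 - xstar) \<le> s / M" for x :: "nat \<Rightarrow> real ^ 'n" and s
    using that M by (simp add: field_simps)
  show ?thesis
  proof (intro exI conjI allI impI)
    show "\<sigma>hat > 0" "\<rho>hat > 0" "2 * C > 0" "(1::real) / 2 < 3 / 4" "(3::real) / 4 < 1"
      using \<sigma>hat \<rho>hat C by auto
  next
    fix x assume x: "newton_anderson f rhat x \<and> projN f xstar (x 0 - xstar) \<noteq> 0 \<and>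
         sig f xstar x 0 < \<sigma>hat \<and> norm (x 0 - xstar) < \<rho>hat"
    then have x': "newton_anderson f rhat x" "projN f xstar (x 0 - xstar) \<noteq> 0"
      "sig f xstar x 0 < \<sigma>hat" "norm (x 0 - xstar) < \<rho>hat" by auto
    show "iter_ok f xstar x" "x \<longlonglongrightarrow> xstar" using main(1,3)[OF x'] by auto
    show "W f xstar x (k + 1) \<subseteq> region f xstar \<rho>hat \<sigma>hat" for k
      using x'(4) \<rho>hat(3) by (intro main(2)[OF x'] bound) auto
    fix k :: nat assume k: "1 \<le> k"
    show "norm (projR f xstar (x (k + 1) - xstar))
         \<le> 2 * C * max (\<bar>1 - na_lambda f rhat x (k + 1) * na_gamma f x (k + 1)\<bar> * (norm (x k - xstar))\<^sup>2)
                 (\<bar>na_lambda f rhat x (k + 1) * na_gamma f x (k + 1)\<bar> * (norm (x (k - 1) - xstar))\<^sup>2)"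
      and "norm (projN f xstar (x (k + 1) - xstar))
         \<le> 3 / 4 * na_theta f rhat x (k + 1) * norm (projN f xstar (x k - xstar))"
      using main(4,5)[OF x' k] by auto
  next
    fix \<sigma> assume \<sigma>: "0 < \<sigma> \<and> \<sigma> < \<sigma>hat"
    show "0 < min \<rho>hat (\<sigma> / M)" "min \<rho>hat (\<sigma> / M) \<le> \<rho>hat" using \<sigma> \<rho>hat M by auto
    fix x k assume x: "newton_anderson f rhat x \<and> projN f xstar (x 0 - xstar) \<noteq> 0 \<and>
              \<sigma> \<le> sig f xstar x 0 \<and> sig f xstar x 0 < \<sigma>hat \<and> norm (x 0 - xstar) < min \<rho>hat (\<sigma> / M)"
    then have x': "newton_anderson f rhat x" "projN f xstar (x 0 - xstar) \<noteq> 0"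
      "sig f xstar x 0 < \<sigma>hat" "norm (x 0 - xstar) < \<rho>hat" by auto
    have "M * norm (x 0 - xstar) \<le> sig f xstar x 0"
      using x bound[of x \<sigma>] by auto
    then show "W f xstar x (k + 1) \<subseteq> W f xstar x 0"
      unfolding W_def[of f xstar x 0] by (intro main(2)[OF x']) auto
  qed
qed

end
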